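(* Let $\lambda/\mu$ be a skew shape with $n$ boxes and let $k$ be a positive integer with $k\mid n$. Suppose that $|\mathrm{BST}(\lambda/\mu,k)|\ge 2$. Then $$|\mathrm{BST}(\lambda/\mu,k)|\ \ge\ \sum_{d\mid \frac nk,\ d>1}|\mathrm{BST}(\lambda/\mu,dk)|.$$ Additionally, the inequality holds (without assuming $|\mathrm{BST}(\lambda/\mu,k)|\ge2$) if $n/k$ is a prime number.
   Context: A border-strip is a connected non-empty skew Young diagram containing no $2\times 2$ square of boxes. For a positive integer $d$, $\mathrm{BST}(\lambda/\mu,d)$ is the set of border-strip tableaux of shape $\lambda/\mu$ with all strips of size $d$: partitions of the diagram of $\lambda/\mu$ into border-strips $B_1,\dots,B_\ell$ ($\ell=|\lambda/\mu|/d$), each with $d$ boxes, where $B_j$ carries label $j$, such that labelling every box of $B_j$ by $j$ gives a filling of $\lambda/\mu$ that is weakly increasing along every row and down every column. *)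

theory Defs
  imports "HOL-Library.Disjoint_Sets" "HOL-Computational_Algebra.Primes"
begin

text \<open>Boxes are pairs (row, column), indexed from 0, in English notation.\<close>

type_synonym box = "nat \<times> nat"

definition is_partition :: "nat list \<Rightarrow> bool" where
  "is_partition xs \<longleftrightarrow> sorted_wrt (\<ge>) xs \<and> 0 \<notin> set xs"

definition young_diagram :: "nat list \<Rightarrow> box set" where
  "young_diagram xs = {(i, j). i < length xs \<and> j < xs ! i}"

definition skew_shape :: "nat list \<Rightarrow> nat list \<Rightarrow> bool" where
  "skew_shape lam mu \<longleftrightarrow>
     is_partition lam \<and> is_partition mu \<and> young_diagram mu \<subseteq> young_diagram lam"

definition skew_diagram :: "nat list \<Rightarrow> nat list \<Rightarrow> box set" where
  "skew_diagram lam mu = young_diagram lam - young_diagram mu"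

text \<open>Two boxes are adjacent if they share an edge.\<close>

definition adjacent :: "box \<Rightarrow> box \<Rightarrow> bool" where
  "adjacent b c \<longleftrightarrow>
     fst b = fst c \<and> (snd c = Suc (snd b) \<or> snd b = Suc (snd c)) \<or>
     snd b = snd c \<and> (fst c = Suc (fst b) \<or> fst b = Suc (fst c))"

definition connected_boxes :: "box set \<Rightarrow> bool" where
  "connected_boxes S \<longleftrightarrow>
     (\<forall>b\<in>S. \<forall>c\<in>S. (b, c) \<in> {(x, y). x \<in> S \<and> y \<in> S \<and> adjacent x y}\<^sup>*)"

definition border_strip :: "box set \<Rightarrow> bool" where
  "border_strip S \<longleftrightarrow>
     (\<exists>lam mu. skew_shape lam mu \<and> S = skew_diagram lam mu) \<and>
     S \<noteq> {} \<and> connected_boxes S \<and>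
     \<not> (\<exists>i j. {(i, j), (i, Suc j), (Suc i, j), (Suc i, Suc j)} \<subseteq> S)"

definition weakly_increasing_filling :: "box set \<Rightarrow> (box \<Rightarrow> nat) \<Rightarrow> bool" where
  "weakly_increasing_filling D T \<longleftrightarrow>
     (\<forall>i j j'. (i, j) \<in> D \<longrightarrow> (i, j') \<in> D \<longrightarrow> j \<le> j' \<longrightarrow> T (i, j) \<le> T (i, j')) \<and>
     (\<forall>i i' j. (i, j) \<in> D \<longrightarrow> (i', j) \<in> D \<longrightarrow> i \<le> i' \<longrightarrow> T (i, j) \<le> T (i', j))"

text \<open>
  The labelled strips are given as the list of B_1, ..., B_l, so that the strip with label j
  is the list entry at index j - 1.
\<close>

definition strip_label :: "box set list \<Rightarrow> box \<Rightarrow> nat" where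
  "strip_label Bs b = (THE j. 1 \<le> j \<and> j \<le> length Bs \<and> b \<in> Bs ! (j - 1))"

text \<open>
  The number of strips need not be prescribed: for a partition into strips of size d
  it is the number of boxes divided by d.
\<close>

definition BST :: "nat list \<Rightarrow> nat list \<Rightarrow> nat \<Rightarrow> box set list set" where
  "BST lam mu d = {Bs. distinct Bs \<and> partition_on (skew_diagram lam mu) (set Bs) \<and>
     (\<forall>B\<in>set Bs. border_strip B \<and> card B = d) \<and>
     weakly_increasing_filling (skew_diagram lam mu) (strip_label Bs)}"

lemma finite_young_diagram: "finite (young_diagram xs)"
proof -
  have "young_diagram xs = (SIGMA i:{..<length xs}. {..<xs ! i})"
    by (auto simp: young_diagram_def)
  then show ?thesis by simp
qed

lemma finite_BST: "finite (BST lam mu d)"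
proof -
  let ?P = "Pow (skew_diagram lam mu)"
  have fin: "finite ?P"
    by (simp add: skew_diagram_def finite_young_diagram)
  have "BST lam mu d \<subseteq> {Bs. set Bs \<subseteq> ?P \<and> length Bs \<le> card ?P}"
  proof
    fix Bs assume "Bs \<in> BST lam mu d"
    then have d: "distinct Bs" and s: "set Bs \<subseteq> ?P"
      by (auto simp: BST_def partition_on_def)
    have "length Bs = card (set Bs)" using d by (simp add: distinct_card)
    also have "\<dots> \<le> card ?P" using fin s by (rule card_mono)
    finally show "Bs \<in> {Bs. set Bs \<subseteq> ?P \<and> length Bs \<le> card ?P}" using s by simp
  qed
  then show ?thesis using finite_lists_length_le[OF fin] by (rule finite_subset)
qed

end

theory Submission
  imports Defs
begin

text \<open>
  Read a Young diagram from its boundary: put a bead on the abacus for every vertical boundary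
  step. Adding a border strip of size \<open>j\<close> means moving one bead by \<open>j\<close> to a free
  position, so a border-strip tableau with strips of size \<open>j\<close> is the same as a word, the list
  of the positions from which the beads are moved (\<open>bij_betw_strips_slides\<close>). Let \<open>W\<close> be
  the set of words for strips of size \<open>k\<close> and \<open>V d\<close> the set of words for strips of size
  \<open>d * k\<close>. It has to be shown that the sets \<open>V d\<close>, \<open>d \<ge> 2\<close>, together have
  at most as many elements as \<open>W\<close>, once \<open>W\<close> has two elements.

  A move by \<open>d * k\<close> can be carried out in \<open>d\<close> moves by \<open>k\<close>. Hence every \<open>v\<close> in
  \<open>V d\<close> has a refinement in \<open>W\<close> (\<open>slides_refine\<close>): a word whose successive blocks
  of \<open>d\<close> letters are rearranged progressions \<open>x, x + k, \<dots>\<close>. Together with \<open>d\<close>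
  the refinement determines \<open>v\<close>, but one word may be a refinement for several \<open>d\<close>. If
  \<open>W\<close> has a single element this cannot be helped: for one row and \<open>k = 1\<close> every divisor
  of the number of boxes contributes one tableau. Otherwise \<open>d\<close> can be written into the word,
  because moves by \<open>k\<close> commute unless their positions differ by exactly \<open>k\<close>. One picks a
  letter \<open>y\<close> behind the first block that commutes with all letters between that block and itself
  and slides it to the place right behind the first block. If \<open>y\<close> can be recognised in the new
  word, its place shows \<open>d\<close>, and \<open>refines_moved_letter\<close> recovers \<open>v\<close>: putting
  \<open>y\<close> back at two different places cannot give two different elements of \<open>V d\<close>.

  If the words of \<open>W\<close> begin with at least two different letters, \<open>y\<close> is the first such
  initial letter after the one that the word begins with. When the first block contains two initial
  letters already, it can be rearranged so that they come first and a letter between them comes last;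
  then \<open>d\<close> is the length of the first prefix that is a progression
  (\<open>sum_le_two_initial_letters\<close>). Reading words backwards turns different last letters into
  different initial letters.

  What remains are the words with a common first letter \<open>x\<close> and a common last letter. They
  describe the standard fillings of a rectangle with more than one row and more than one column, so
  \<open>x + k\<close> and \<open>x - k\<close> both occur, and \<open>x\<close> occurs again. If the first block
  contains only one of \<open>x + k\<close> and \<open>x - k\<close>, the other one serves as \<open>y\<close>. If it
  contains both, \<open>y\<close> is the second \<open>x\<close>, and the first block is arranged in such a way
  that the outcome is not also produced by a tableau with \<open>d = 2\<close>; the sizes \<open>d = 3\<close>
  and \<open>d = 4\<close> need a variant (\<open>sum_le_fixed_ends\<close>).

  When \<open>n / k\<close> is prime, the sum has the single term for strips of size \<open>n\<close>, which is at
  most \<open>1\<close>, and a refinement shows that \<open>W\<close> is not empty if that term is \<open>1\<close>.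
\<close>

section \<open>Moving beads\<close>

text \<open>
  The abacus: \<open>X\<close> and \<open>Y\<close> are the sets of bead positions before and after the moves,
  and the letters of the word are the positions that the moving beads leave.
\<close>

fun slides :: "int \<Rightarrow> int set \<Rightarrow> int list \<Rightarrow> int set \<Rightarrow> bool" where
  "slides k X [] Y \<longleftrightarrow> X = Y"
| "slides k X (a # w) Y \<longleftrightarrow> a \<in> X \<and> a + k \<notin> X \<and> slides k (insert (a + k) (X - {a})) w Y"

text \<open>
  The only obstruction to exchanging two consecutive moves.
\<close>

definition adj :: "int \<Rightarrow> int \<Rightarrow> int \<Rightarrow> bool" where
  "adj k a b \<longleftrightarrow> b = a + k \<or> a = b + k"

lemma adj_commute: "adj k a b \<longleftrightarrow> adj k b a"
  by (auto simp: adj_def)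

lemma slides_append:
  "slides k X (u @ v) Y \<longleftrightarrow> (\<exists>Z. slides k X u Z \<and> slides k Z v Y)"
  by (induction u arbitrary: X) auto

text \<open>
  A move away from \<open>p - k\<close> fills \<open>p\<close>, a move away from \<open>p\<close> empties it.
\<close>

lemma slides_count:
  assumes "k > 0" "slides k X w Y"
  shows "of_bool (p \<in> Y) = of_bool (p \<in> X) + int (count_list w (p - k)) - int (count_list w p)"
  using assms(2)
proof (induction w arbitrary: X)
  case (Cons a w)
  then have "of_bool (p \<in> Y) = of_bool (p \<in> insert (a + k) (X - {a}))
      + int (count_list w (p - k)) - int (count_list w p)"
    by (intro Cons.IH) auto
  then show ?case using assms(1) Cons.prems by (cases "p = a + k"; cases "p = a") auto
qed auto

text \<open>
  By \<open>slides_count\<close> the difference of the two letter counts is invariant under translation by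
  \<open>k\<close>. It has finite support, so it vanishes.
\<close>

lemma slides_mset:
  assumes k: "k > 0" and w: "slides k X w Y" and w': "slides k X w' Y"
  shows "mset w = mset w'"
proof -
  define g where "g p = int (count_list w p) - int (count_list w' p)" for p
  have step: "g p = g (p - k)" for p
    using slides_count[OF k w, of p] slides_count[OF k w', of p] by (simp add: g_def)
  have shift: "g (p - int i * k) = g p" for p i
  proof (induction i)
    case (Suc i)
    have "g (p - int (Suc i) * k) = g (p - int i * k - k)" by (simp add: algebra_simps)
    also have "\<dots> = g (p - int i * k)" using step[of "p - int i * k"] by simp
    finally show ?case using Suc by simp
  qed simp
  have "g p = 0" for p
  proof (rule ccontr)
    assume "g p \<noteq> 0"
    then have nz: "g (p - int i * k) \<noteq> 0" for i by (simp add: shift)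
    have "p - int i * k \<in> set w \<union> set w'" for i
      using nz[of i] by (force simp: g_def count_list_0_iff)
    then have "range (\<lambda>i. p - int i * k) \<subseteq> set w \<union> set w'" by blast
    then have "finite (range (\<lambda>i. p - int i * k))" by (rule finite_subset) simp
    moreover have "inj (\<lambda>i. p - int i * k)" using k by (auto simp: inj_on_def)
    ultimately show False using finite_imageD infinite_UNIV_nat by blast
  qed
  then have "count (mset w) p = count (mset w') p" for p
    by (simp add: g_def count_mset count_list_eq_length_filter)
  then show ?thesis by (simp add: multiset_eq_iff)
qed

lemma slides_swap:
  assumes "slides k X (a # b # w) Y" "\<not> adj k a b"
  shows "slides k X (b # a # w) Y"
proof -
  have eq: "insert (b + k) (insert (a + k) (X - {a}) - {b}) = insert (a + k) (insert (b + k) (X - {b}) - {a})"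
    using assms by (auto simp: adj_def)
  show ?thesis using assms eq by (auto simp: adj_def)
qed

lemma slides_pull:
  assumes "slides k X (p @ us @ c # vs) Y" "\<And>u. u \<in> set us \<Longrightarrow> \<not> adj k u c"
  shows "slides k X (p @ c # us @ vs) Y"
  using assms
proof (induction us arbitrary: vs rule: rev_induct)
  case (snoc a us)
  obtain Z where Z: "slides k X (p @ us) Z" "slides k Z (a # c # vs) Y"
    using snoc.prems(1) slides_append[of k X "p @ us" "a # c # vs" Y] by auto
  have "slides k Z (c # a # vs) Y" by (rule slides_swap[OF Z(2)]) (use snoc.prems(2) in auto)
  then have "slides k X (p @ us @ c # (a # vs)) Y"
    using Z(1) slides_append[of k X "p @ us" "c # a # vs" Y] by auto
  from snoc.IH[OF this] snoc.prems(2) show ?case by simp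
qed simp

lemma slides_push:
  assumes "slides k X (p @ c # us @ vs) Y" "\<And>u. u \<in> set us \<Longrightarrow> \<not> adj k u c"
  shows "slides k X (p @ us @ c # vs) Y"
  using assms
proof (induction us arbitrary: p)
  case (Cons a us)
  obtain Z where Z: "slides k X p Z" "slides k Z (c # a # us @ vs) Y"
    using Cons.prems(1) slides_append[of k X p "c # a # us @ vs" Y] by auto
  have "slides k Z (a # c # us @ vs) Y"
    by (rule slides_swap[OF Z(2)]) (use Cons.prems(2) in \<open>auto simp: adj_commute\<close>)
  then have "slides k X ((p @ [a]) @ c # us @ vs) Y"
    using Z(1) slides_append[of k X p "a # c # us @ vs" Y] by auto
  from Cons.IH[OF this] Cons.prems(2) show ?case by simp
qed simp

lemma slides_becomes_full: "slides k Z us Z' \<Longrightarrow> a \<notin> Z \<Longrightarrow> a \<in> Z' \<Longrightarrow> a - k \<in> set us"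
  by (induction us arbitrary: Z) force+

lemma slides_becomes_empty: "slides k Z us Z' \<Longrightarrow> a \<in> Z \<Longrightarrow> a \<notin> Z' \<Longrightarrow> a \<in> set us"
  by (induction us arbitrary: Z) force+

text \<open>
  After a bead has left \<open>a\<close>, the place \<open>a\<close> is only refilled from \<open>a - k\<close>, and
  the place \<open>a + k\<close> has to be vacated before the next bead arrives from \<open>a\<close>.
\<close>

lemma slides_between:
  assumes k: "k > 0" and "slides k X (p @ a # us @ a # vs) Y"
  shows "a + k \<in> set us" "a - k \<in> set us"
proof -
  obtain Z where "slides k Z (a # us @ a # vs) Y"
    using assms(2) slides_append by blast
  then obtain Z' where 1: "slides k (insert (a + k) (Z - {a})) us Z'" and 2: "slides k Z' (a # vs) Y"
    using slides_append[of k _ us "a # vs" Y] by auto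
  from 2 have "a \<in> Z'" "a + k \<notin> Z'" by auto
  then show "a + k \<in> set us" "a - k \<in> set us"
    using slides_becomes_full[OF 1, of a] slides_becomes_empty[OF 1, of "a + k"] k by auto
qed

text \<open>
  As long as the bead at \<open>y\<close> stays, the place \<open>y\<close> blocks the move away from
  \<open>y - k\<close>, and the place \<open>y + k\<close> remains empty.
\<close>

lemma slides_first_letter_free:
  assumes "k > 0" "slides k X us Z" "y \<in> X" "y + k \<notin> X" "y \<notin> set us" "u \<in> set us"
  shows "\<not> adj k u y"
  using assms(2-)
proof (induction us arbitrary: X)
  case (Cons a us)
  then have ne: "a \<noteq> y" "a \<noteq> y + k" "a + k \<noteq> y" by auto
  then have "\<not> adj k a y" by (auto simp: adj_def)
  moreover have "\<not> adj k u y" if "u \<in> set us"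
    by (rule Cons.IH[of "insert (a + k) (X - {a})"]) (use Cons.prems ne that in auto)
  ultimately show ?case using Cons.prems by auto
qed simp

text \<open>
  Backwards in time the beads move to the left, that is, the holes move to the right; the hole that
  comes from the move \<open>a\<close> starts at \<open>a\<close> again, so the letters stay the same.
\<close>

lemma slides_rev: "slides k X w Y \<longleftrightarrow> slides k (- Y) (rev w) (- X)" if "k > 0"
proof -
  have *: "slides k (- Y) (rev w) (- X)" if "slides k X w Y" for X w Y
    using that
  proof (induction w arbitrary: X)
    case (Cons a w)
    let ?X' = "insert (a + k) (X - {a})"
    have "slides k (- Y) (rev w) (- ?X')" using Cons by auto
    moreover have "slides k (- ?X') [a] (- X)" using Cons.prems \<open>k > 0\<close> by auto
    ultimately show ?case using slides_append by auto
  qed auto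
  show ?thesis using *[of X w Y] *[of "- Y" "rev w" "- X"] by auto
qed

section \<open>Cutting long moves into short ones\<close>

text \<open>
  The positions that a bead passes when it moves by \<open>d * k\<close> in steps of \<open>k\<close>.
\<close>

definition blk :: "int \<Rightarrow> nat \<Rightarrow> int \<Rightarrow> int set" where
  "blk k d x = (\<lambda>i. x + int i * k) ` {..<d}"

lemma mem_blk: "c \<in> blk k d x \<longleftrightarrow> (\<exists>i<d. c = x + int i * k)"
  by (auto simp: blk_def)

lemma card_blk: "k > 0 \<Longrightarrow> card (blk k d x) = d"
  unfolding blk_def by (subst card_image) (auto simp: inj_on_def)

lemma blk_inject:
  assumes "k > 0" "d > 0" "blk k d x = blk k d y"
  shows "x = y"
proof -
  have "x \<in> blk k d x" "y \<in> blk k d y" using assms(2) by (force simp: blk_def)+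
  then have "x \<in> blk k d y" "y \<in> blk k d x" using assms(3) by simp_all
  then obtain i j where "x = y + int i * k" "y = x + int j * k" unfolding mem_blk by blast
  moreover have "int i * k \<ge> 0" "int j * k \<ge> 0" using \<open>k > 0\<close> by simp_all
  ultimately show ?thesis by linarith
qed

lemma blk_neighbour:
  assumes "c \<in> blk k d x" "d \<ge> 2" "k > 0"
  shows "\<exists>b\<in>blk k d x. adj k b c"
proof -
  obtain i where i: "i < d" "c = x + int i * k" using assms by (auto simp: mem_blk)
  show ?thesis
  proof (cases i)
    case 0
    then have "x + int 1 * k \<in> blk k d x" unfolding mem_blk using assms by (intro exI[of _ 1]) auto
    then show ?thesis using 0 i by (intro bexI[of _ "x + int 1 * k"]) (auto simp: adj_def)
  next
    case (Suc j)
    then have "x + int j * k \<in> blk k d x" unfolding mem_blk using i by (intro exI[of _ j]) auto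
    then show ?thesis using Suc i
      by (intro bexI[of _ "x + int j * k"]) (auto simp: adj_def algebra_simps)
  qed
qed

lemma blk_convex:
  assumes "a \<in> blk k e c" "b \<in> blk k e c" "a \<le> z" "z \<le> b" "k dvd (z - a)" "k > 0"
  shows "z \<in> blk k e c"
proof -
  obtain i j where ij: "i < e" "a = c + int i * k" "j < e" "b = c + int j * k"
    using assms by (auto simp: mem_blk)
  obtain q where q: "z - a = k * q" using assms(5) by auto
  have "q \<ge> 0" using q assms by (smt (verit) mult_pos_neg)
  have "z = c + (int i + q) * k" using q ij by (simp add: algebra_simps)
  moreover have "int i + q \<le> int j"
  proof (rule ccontr)
    assume "\<not> ?thesis"
    then have "int j * k < (int i + q) * k" using assms(6) by auto
    then show False using \<open>z = _\<close> ij assms by linarith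
  qed
  ultimately show ?thesis using \<open>q \<ge> 0\<close> ij unfolding mem_blk
    by (intro exI[of _ "nat (int i + q)"]) auto
qed

text \<open>
  Every chunk of \<open>d\<close> letters of \<open>T\<close> carries out one long move of \<open>v\<close>. Only the set
  of letters of a chunk is prescribed: their order depends on the beads that stand in the way.
\<close>

definition refines :: "int \<Rightarrow> nat \<Rightarrow> int list \<Rightarrow> int list \<Rightarrow> bool" where
  "refines k d T v \<longleftrightarrow> length T = d * length v \<and>
     (\<forall>j<length v. set (take d (drop (j * d) T)) = blk k d (v ! j))"

text \<open>
  If a bead stands at the last intermediate position, it makes the last step first; otherwise the last
  step comes at the end.
\<close>

lemma slides_block:
  assumes "k > 0" "d > 0" "x \<in> X" "x + int d * k \<notin> X"
  shows "\<exists>t. slides k X t (insert (x + int d * k) (X - {x})) \<and> length t = d \<and> set t = blk k d x"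
  using assms(2-4)
proof (induction d arbitrary: X rule: nat_induct_non_zero)
  case 1
  then show ?case by (intro exI[of _ "[x]"]) (auto simp: blk_def)
next
  case (Suc d)
  let ?c = "x + int d * k"
  have c: "?c + k = x + int (Suc d) * k" by (simp add: algebra_simps)
  have bs: "blk k (Suc d) x = insert ?c (blk k d x)" by (auto simp: blk_def lessThan_Suc)
  have cx: "?c \<noteq> x" using \<open>k > 0\<close> Suc.hyps by auto
  show ?case
  proof (cases "?c \<in> X")
    case True
    let ?X = "insert (?c + k) (X - {?c})"
    have "?c \<notin> ?X" using \<open>k > 0\<close> by auto
    moreover have "x \<in> ?X" using cx Suc.prems by auto
    ultimately obtain t where t: "slides k ?X t (insert ?c (?X - {x}))" "length t = d" "set t = blk k d x"
      using Suc.IH[of ?X] by blast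
    have eq: "insert ?c (?X - {x}) = insert (?c + k) (X - {x})" using True cx Suc.prems c \<open>k > 0\<close> by auto
    have "?c + k \<notin> X" unfolding c by (rule Suc.prems(2))
    then have "slides k X (?c # t) (insert (?c + k) (X - {x}))"
      using t(1)[unfolded eq] True by simp
    then show ?thesis unfolding c[symmetric] bs using t(2,3) by (intro exI[of _ "?c # t"]) auto
  next
    case False
    obtain t where t: "slides k X t (insert ?c (X - {x}))" "length t = d" "set t = blk k d x"
      using Suc.IH[of X] False Suc.prems by blast
    have "insert (?c + k) (insert ?c (X - {x}) - {?c}) = insert (?c + k) (X - {x})"
      using False by auto
    moreover have "?c + k \<notin> X" unfolding c by (rule Suc.prems(2))
    then have "?c + k \<notin> insert ?c (X - {x})" using \<open>k > 0\<close> by auto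
    ultimately have "slides k (insert ?c (X - {x})) [?c] (insert (?c + k) (X - {x}))" by simp
    then have "slides k X (t @ [?c]) (insert (?c + k) (X - {x}))"
      using t(1) slides_append by blast
    then show ?thesis unfolding c[symmetric] bs using t(2,3) by (intro exI[of _ "t @ [?c]"]) auto
  qed
qed

lemma refines_Cons:
  assumes "length t = d" "set t = blk k d x" "refines k d T v"
  shows "refines k d (t @ T) (x # v)"
  unfolding refines_def
proof (intro conjI allI impI)
  fix j assume "j < length (x # v)"
  then show "set (take d (drop (j * d) (t @ T))) = blk k d ((x # v) ! j)"
    using assms by (cases j) (auto simp: refines_def)
qed (use assms in \<open>auto simp: refines_def\<close>)

lemma slides_refine:
  assumes "k > 0" "d > 0" "slides (int d * k) X v Y"
  shows "\<exists>T. slides k X T Y \<and> refines k d T v"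
  using assms(3)
proof (induction v arbitrary: X)
  case Nil
  then show ?case by (intro exI[of _ "[]"]) (auto simp: refines_def)
next
  case (Cons x v)
  then obtain T where T: "slides k (insert (x + int d * k) (X - {x})) T Y" "refines k d T v"
    by auto
  obtain t where t: "slides k X t (insert (x + int d * k) (X - {x}))" "length t = d" "set t = blk k d x"
    using slides_block[of k d x X] assms(1,2) Cons.prems by auto
  have "slides k X (t @ T) Y" using T t slides_append by blast
  moreover have "refines k d (t @ T) (x # v)" using refines_Cons T t by blast
  ultimately show ?case by blast
qed

lemma refines_unique:
  assumes "k > 0" "d > 0" "refines k d T v" "refines k d T' v'" "length T = length T'"
    and "\<And>j. j < length v \<Longrightarrow> set (take d (drop (j * d) T)) = set (take d (drop (j * d) T'))"
  shows "v = v'"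
proof (rule nth_equalityI)
  show "length v = length v'" using assms by (auto simp: refines_def)
  fix j assume j: "j < length v"
  then have "blk k d (v ! j) = blk k d (v' ! j)"
    using assms by (auto simp: refines_def)
  then show "v ! j = v' ! j" using blk_inject assms by blast
qed

lemma refines_replace:
  assumes "refines k d (p @ t @ s) v" "length t = d" "length t' = d" "set t = set t'"
    and "length p = i * d" "d > 0"
  shows "refines k d (p @ t' @ s) v"
  unfolding refines_def
proof (intro conjI allI impI)
  show "length (p @ t' @ s) = d * length v" using assms by (auto simp: refines_def)
  fix j assume j: "j < length v"
  have old: "set (take d (drop (j * d) (p @ t @ s))) = blk k d (v ! j)"
    using assms j by (auto simp: refines_def)
  consider "j < i" | "j = i" | "j > i" by linarith
  then show "set (take d (drop (j * d) (p @ t' @ s))) = blk k d (v ! j)"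
  proof cases
    case 1
    then have "Suc j * d \<le> i * d" by (intro mult_le_mono1) simp
    then have "j * d + d \<le> length p" using assms by simp
    then show ?thesis using old by simp
  next
    case 2
    then show ?thesis using old assms by simp
  next
    case 3
    then have "Suc i * d \<le> j * d" by (intro mult_le_mono1) simp
    then have "length p + d \<le> j * d" using assms by simp
    then have "drop (j * d) (p @ t' @ s) = drop (j * d) (p @ t @ s)"
      using assms by (simp add: drop_Cons')
    then show ?thesis using old by simp
  qed
qed

lemma refines_first_block:
  assumes "refines k d T v" "d > 0" "k > 0" "T \<noteq> []"
  shows "length (take d T) = d" "set (take d T) = blk k d (v ! 0)" "distinct (take d T)" "v \<noteq> []"
proof -
  show v: "v \<noteq> []" using assms by (auto simp: refines_def)
  then have "d \<le> length T" using assms(1) by (cases v) (auto simp: refines_def)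
  then show l: "length (take d T) = d" by simp
  show s: "set (take d T) = blk k d (v ! 0)" using assms(1) v by (force simp: refines_def)
  show "distinct (take d T)" using l s card_blk[OF assms(3), of d] by (metis card_distinct)
qed

text \<open>
  If a chunk of \<open>T\<close> contained \<open>y\<close> but ended before \<open>y\<close>'s place in the other word,
  its letters would all come from \<open>us\<close>, \<open>y\<close> and \<open>ws\<close>. But a progression of at least
  two letters contains a neighbour of \<open>y\<close>. So both places of \<open>y\<close> belong to the same chunk,
  and the two words have the same chunks.
\<close>

lemma refines_moved_letter_aux:
  assumes "k > 0" "d \<ge> 2"
    and v: "refines k d (t @ us @ y # ws @ vs) v" and v': "refines k d (t @ us @ ws @ y # vs) v'"
    and t: "length t = d"
    and na: "\<And>u. u \<in> set us \<union> set ws \<Longrightarrow> \<not> adj k u y"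
  shows "v = v'"
proof -
  let ?T = "t @ us @ y # ws @ vs" and ?T' = "t @ us @ ws @ y # vs"
  define p where "p = d + length us"
  \<comment> \<open>The chunk of \<open>?T\<close> that contains this \<open>y\<close>; it is not the first one.\<close>
  define i where "i = p div d"
  have lenT: "length ?T = d * length v" using v by (simp add: refines_def)
  have "p = i * d + p mod d" by (simp add: i_def)
  moreover have "p mod d < d" using assms(2) by simp
  ultimately have ip: "i * d \<le> p" "p < i * d + d" by linarith+
  have "d * 1 \<le> p" by (simp add: p_def)
  then have i1: "i \<ge> 1" using assms(2) unfolding i_def by (simp add: less_eq_div_iff_mult_less_eq)
  have iv: "i < length v"
  proof -
    have "p < d * length v" using lenT by (auto simp: p_def t)
    then show ?thesis unfolding i_def by (simp add: mult.commute less_mult_imp_div_less)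
  qed
  have yT: "?T ! p = y" by (simp add: p_def t nth_append)
  have blkT: "set (take d (drop (i * d) ?T)) = blk k d (v ! i)" using v iv by (simp add: refines_def)
  have fits: "i * d + d \<le> length ?T"
  proof -
    have "Suc i * d \<le> length v * d" using iv by (intro mult_le_mono1) simp
    then show ?thesis using lenT by (simp add: mult.commute)
  qed
  have big: "p + length ws < i * d + d"
  proof (rule ccontr)
    assume neg: "\<not> ?thesis"
    have "y \<in> set (take d (drop (i * d) ?T))"
    proof -
      have "take d (drop (i * d) ?T) ! (p - i * d) = drop (i * d) ?T ! (p - i * d)"
        using ip by (intro nth_take) linarith
      also have "\<dots> = ?T ! (i * d + (p - i * d))"
        using ip fits by (intro nth_drop) linarith
      finally have "take d (drop (i * d) ?T) ! (p - i * d) = y" using ip yT by simp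
      moreover have "p - i * d < length (take d (drop (i * d) ?T))"
        using ip fits unfolding length_take length_drop by linarith
      ultimately show ?thesis using nth_mem by metis
    qed
    then obtain b where b: "b \<in> set (take d (drop (i * d) ?T))" "adj k b y"
      using blk_neighbour[of y k d "v ! i"] assms(1,2) blkT by blast
    have "b \<noteq> y" using b(2) assms(1) by (auto simp: adj_def)
    define j where "j = i * d - d"
    have j: "i * d = length t + j" using i1 t by (simp add: j_def Suc_le_eq)
    have "set (take d (drop (i * d) ?T)) = set (take d (drop j (us @ y # ws @ vs)))"
      unfolding j by simp
    also have "take d (drop j (us @ y # ws @ vs)) = take d (drop j ((us @ y # ws) @ vs))"
      by simp
    also have "\<dots> = take d (drop j (us @ y # ws))"
    proof -
      have "j + d \<le> length (us @ y # ws)" using neg j t by (simp add: p_def)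
      then show ?thesis by (simp del: append_assoc append_Cons)
    qed
    finally have "b \<in> set (us @ y # ws)" using b(1) by (metis in_set_takeD in_set_dropD)
    then show False using b(2) \<open>b \<noteq> y\<close> na by auto
  qed
  show ?thesis
  proof (rule refines_unique[OF assms(1) _ v v'])
    fix j assume "j < length v"
    consider "j < i" | "j = i" | "j > i" by linarith
    then show "set (take d (drop (j * d) ?T)) = set (take d (drop (j * d) ?T'))"
    proof cases
      case 1
      then have "Suc j * d \<le> i * d" by (intro mult_le_mono1) simp
      then have "j * d + d \<le> length (t @ us)" using ip by (simp add: p_def t)
      then have "take d (drop (j * d) ((t @ us) @ r)) = take d (drop (j * d) (t @ us))" for r
        by (simp del: append_assoc)
      then show ?thesis by (metis append_assoc)
    next
      case 2
      define q where "q = i * d"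
      define e where "e = q + d - (length (t @ us) + length ws + 1)"
      define A where "A = t @ us"
      have q: "q \<le> length A" "d - (length A - q) = Suc (length ws) + e"
        using ip big by (auto simp: q_def p_def t e_def A_def)
      have "take d (drop q (A @ r)) = take d (drop q A) @ take (Suc (length ws) + e) r" for r
        using q by simp
      from this[of "y # ws @ vs"] this[of "ws @ y # vs"]
      show ?thesis using 2 by (simp add: q_def A_def)
    next
      case 3
      then have "Suc i * d \<le> j * d" by (intro mult_le_mono1) simp
      then have *: "length (t @ us) + length ws < j * d" using big by (simp add: p_def t)
      define e where "e = j * d - (length (t @ us) + length ws + 1)"
      have e: "j * d = length (t @ us) + (Suc (length ws) + e)" using * by (simp add: e_def)
      have "drop (j * d) ((t @ us) @ r) = drop (Suc (length ws) + e) r" for r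
        unfolding e by (simp del: append_assoc)
      from this[of "y # ws @ vs"] this[of "ws @ y # vs"]
      show ?thesis by simp
    qed
  qed (use assms(2) in auto)
qed

text \<open>
  A letter that was slid to the place right behind the first block can be put back in essentially one
  way.
\<close>

lemma refines_moved_letter:
  assumes "k > 0" "d \<ge> 2" "length t = d"
    and "refines k d (t @ us @ y # vs) v" "refines k d (t @ us' @ y # vs') v'"
    and "us @ vs = us' @ vs'"
    and "\<And>u. u \<in> set us \<union> set us' \<Longrightarrow> \<not> adj k u y"
  shows "v = v'"
proof -
  from assms(6) obtain ws where "us = us' @ ws \<and> ws @ vs = vs' \<or> us @ ws = us' \<and> vs = ws @ vs'"
    by (auto simp: append_eq_append_conv2)
  then show ?thesis
    using refines_moved_letter_aux[of k d t us y ws vs' v v']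
      refines_moved_letter_aux[of k d t us' y ws vs v' v] assms by auto
qed

section \<open>Border strips as bead moves\<close>

text \<open>
  Young diagrams of partitions without the reference to a list of row lengths.
\<close>

definition lower :: "box set \<Rightarrow> bool" where
  "lower L \<longleftrightarrow> (\<forall>i j i' j'. (i, j) \<in> L \<longrightarrow> i' \<le> i \<longrightarrow> j' \<le> j \<longrightarrow> (i', j') \<in> L)"

lemma lowerD: "lower L \<Longrightarrow> (i, j) \<in> L \<Longrightarrow> i' \<le> i \<Longrightarrow> j' \<le> j \<Longrightarrow> (i', j') \<in> L"
  unfolding lower_def by blast

lemma lowerI:
  assumes "\<And>i j. (Suc i, j) \<in> L \<Longrightarrow> (i, j) \<in> L" "\<And>i j. (i, Suc j) \<in> L \<Longrightarrow> (i, j) \<in> L"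
  shows "lower L"
proof -
  have 1: "(i + a, j) \<in> L \<Longrightarrow> (i, j) \<in> L" for i a j by (induction a) (auto dest: assms(1))
  have 2: "(i, j + a) \<in> L \<Longrightarrow> (i, j) \<in> L" for i a j by (induction a) (auto dest: assms(2))
  show ?thesis unfolding lower_def
  proof (intro allI impI)
    fix i j i' j' :: nat assume "(i, j) \<in> L" "i' \<le> i" "j' \<le> j"
    then show "(i', j') \<in> L" using 1[of i' "i - i'" j] 2[of i' j' "j - j'"] by simp
  qed
qed

lemma lower_young_diagram:
  assumes "is_partition xs"
  shows "lower (young_diagram xs)"
  unfolding lower_def
proof (intro allI impI)
  fix i j i' j' assume "(i, j) \<in> young_diagram xs" "i' \<le> i" "j' \<le> j"
  then have *: "i < length xs" "j < xs ! i" by (auto simp: young_diagram_def)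
  have "xs ! i \<le> xs ! i'"
    using assms * \<open>i' \<le> i\<close> by (cases "i' = i") (auto simp: is_partition_def sorted_wrt_iff_nth_less)
  then show "(i', j') \<in> young_diagram xs" using * \<open>i' \<le> i\<close> \<open>j' \<le> j\<close> by (auto simp: young_diagram_def)
qed

lemma initial_segment:
  fixes S :: "nat set"
  assumes "finite S" "\<And>t u. t \<in> S \<Longrightarrow> u \<le> t \<Longrightarrow> u \<in> S"
  shows "t \<in> S \<longleftrightarrow> t < card S"
proof -
  have ex: "\<exists>n. n \<notin> S" using assms(1) ex_new_if_finite[OF infinite_UNIV_nat] by blast
  define n where "n = (LEAST n. n \<notin> S)"
  have n: "n \<notin> S" "t < n \<Longrightarrow> t \<in> S" for t
    using LeastI_ex[OF ex] not_less_Least unfolding n_def by blast+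
  have "S = {..<n}"
  proof (intro set_eqI iffI)
    fix t assume "t \<in> S"
    then have "\<not> n \<le> t" using n(1) assms(2) by blast
    then show "t \<in> {..<n}" by simp
  qed (use n(2) in simp)
  then show ?thesis by simp
qed

lemma lower_is_young_diagram:
  assumes "lower L" "finite L"
  shows "\<exists>xs. is_partition xs \<and> young_diagram xs = L"
proof -
  define row where "row i = card {j. (i, j) \<in> L}" for i
  have fin_row: "finite {j. (i, j) \<in> L}" for i
    by (rule finite_subset[OF _ finite_imageI[OF assms(2), of snd]]) force
  have row: "(i, j) \<in> L \<longleftrightarrow> j < row i" for i j
    using initial_segment[OF fin_row[of i], of j] lowerD[OF assms(1)] unfolding row_def mem_Collect_eq by blast
  define n where "n = card {i. (i, 0) \<in> L}"
  have "finite {i. (i, 0) \<in> L}"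
    by (rule finite_subset[OF _ finite_imageI[OF assms(2), of fst]]) force
  then have n: "(i, 0) \<in> L \<longleftrightarrow> i < n" for i
    using initial_segment[of "{i. (i, 0) \<in> L}" i] lowerD[OF assms(1)] unfolding n_def mem_Collect_eq by blast
  have anti: "row i \<le> row i'" if "i' \<le> i" for i i'
  proof (rule ccontr)
    assume "\<not> ?thesis"
    then have "(i, row i') \<in> L" using row by simp
    then have "(i', row i') \<in> L" using lowerD[OF assms(1)] that by blast
    then show False using row by simp
  qed
  let ?xs = "map row [0..<n]"
  have "row i \<noteq> 0" if "i < n" for i using n[of i] row[of i 0] that by simp
  then have "is_partition ?xs"
    using anti by (fastforce simp: is_partition_def sorted_wrt_iff_nth_less)
  moreover have "young_diagram ?xs = L"
  proof -
    have "(i, j) \<in> young_diagram ?xs \<longleftrightarrow> (i, j) \<in> L" for i j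
      using n[of i] row[of i] by (cases "i < n") (auto simp: young_diagram_def)
    then show ?thesis by auto
  qed
  ultimately show ?thesis by blast
qed

definition content :: "box \<Rightarrow> int" where
  "content b = int (snd b) - int (fst b)"

definition diag :: "int \<Rightarrow> nat \<Rightarrow> box" where
  "diag c t = (t + nat (- c), t + nat c)"

lemma content_diag [simp]: "content (diag c t) = c"
  by (simp add: content_def diag_def)

lemma diag_content: "diag (content b) (min (fst b) (snd b)) = b"
  by (cases b) (auto simp: content_def diag_def min_def)

lemma diag_inject [simp]: "diag c t = diag c' t' \<longleftrightarrow> c = c' \<and> t = t'"
proof
  assume *: "diag c t = diag c' t'"
  then have "c = c'" using content_diag by metis
  then show "c = c' \<and> t = t'" using * by (simp add: diag_def)
qed simp

text \<open>
  The length of the diagonal with content \<open>c\<close>; a finite lower set is determined by these numbers.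
\<close>

definition depth :: "box set \<Rightarrow> int \<Rightarrow> nat" where
  "depth L c = card {t. diag c t \<in> L}"

lemma finite_diag: "finite L \<Longrightarrow> finite {t. diag c t \<in> L}"
  by (rule finite_imageD[of "diag c"]) (auto intro: finite_subset simp: inj_on_def)

lemma mem_depth:
  assumes "lower L" "finite L"
  shows "diag c t \<in> L \<longleftrightarrow> t < depth L c"
proof -
  have "diag c u \<in> L" if "diag c t \<in> L" "u \<le> t" for t u
    using lowerD[OF assms(1)] that unfolding diag_def by (meson add_le_mono1)
  then show ?thesis
    using initial_segment[OF finite_diag[OF assms(2)], of c t] unfolding depth_def mem_Collect_eq by blast
qed

lemma mem_iff_depth:
  assumes "lower L" "finite L"
  shows "b \<in> L \<longleftrightarrow> min (fst b) (snd b) < depth L (content b)"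
  using mem_depth[OF assms, of "content b"] diag_content[of b] by metis

text \<open>
  The correction term accounts for the corner of the quadrant, where the empty diagram's boundary
  turns from vertical to horizontal. For a diagram the value is \<open>0\<close> if the boundary step between
  the diagonals \<open>c\<close> and \<open>c + 1\<close> is vertical, and \<open>1\<close> if it is horizontal.
\<close>

definition jump :: "(int \<Rightarrow> nat) \<Rightarrow> int \<Rightarrow> int" where
  "jump D c = int (D (c + 1)) - int (D c) + of_bool (c \<ge> 0)"

lemma jump_depth:
  assumes "lower L" "finite L"
  shows "jump (depth L) c \<in> {0, 1}"
proof -
  have le: "depth L a \<le> depth L b" if "\<And>t. diag a t \<in> L \<Longrightarrow> diag b t \<in> L" for a b
    using that[of "depth L b"] mem_depth[OF assms, of a "depth L b"] mem_depth[OF assms, of b "depth L b"]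
    by linarith
  have le_Suc: "depth L a \<le> Suc (depth L b)" if "\<And>t. diag a (Suc t) \<in> L \<Longrightarrow> diag b t \<in> L" for a b
    using that[of "depth L b"] mem_depth[OF assms, of a "Suc (depth L b)"] mem_depth[OF assms, of b "depth L b"]
    by linarith
  show ?thesis
  proof (cases "c \<ge> 0")
    case True
    have "depth L (c + 1) \<le> depth L c"
      by (rule le) (use True in \<open>auto simp: diag_def intro: lowerD[OF assms(1)]\<close>)
    moreover have "depth L c \<le> Suc (depth L (c + 1))"
      by (rule le_Suc) (use True in \<open>auto simp: diag_def nat_add_distrib intro: lowerD[OF assms(1)]\<close>)
    ultimately show ?thesis using True by (auto simp: jump_def)
  next
    case False
    then have c: "nat (- c) = Suc (nat (- (c + 1)))" by simp
    have "depth L c \<le> depth L (c + 1)"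
      by (rule le) (use False c in \<open>auto simp: diag_def intro: lowerD[OF assms(1)]\<close>)
    moreover have "depth L (c + 1) \<le> Suc (depth L c)"
      by (rule le_Suc) (use False c in \<open>auto simp: diag_def intro: lowerD[OF assms(1)]\<close>)
    ultimately show ?thesis using False by (auto simp: jump_def)
  qed
qed

text \<open>
  For a partition \<open>\<lambda>\<close> these are the numbers \<open>\<lambda>\<^sub>i - i - 1\<close>, where rows are counted
  from \<open>0\<close> and the sequence is continued by zeros.
\<close>

definition beads :: "box set \<Rightarrow> int set" where
  "beads L = {c. jump (depth L) c = 0}"

text \<open>
  Equal beads give diagonal lengths that differ by a constant, and far away all diagonals are empty.
\<close>

lemma beads_inject:
  assumes L: "lower L" "finite L" and M: "lower M" "finite M" and eq: "beads L = beads M"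
  shows "L = M"
proof -
  have j: "jump (depth L) c = jump (depth M) c" for c
  proof -
    have "jump (depth L) c = 0 \<longleftrightarrow> jump (depth M) c = 0" using eq by (auto simp: beads_def)
    then show ?thesis using jump_depth[OF L, of c] jump_depth[OF M, of c] by auto
  qed
  define e where "e c = int (depth L c) - int (depth M c)" for c
  have "e (c + 1) = e c" for c using j[of c] by (simp add: jump_def e_def)
  then have e: "e (c + int i) = e c" for c i
  proof (induction i)
    case (Suc i)
    have "e (c + int (Suc i)) = e (c + int i + 1)" by (simp add: algebra_simps)
    then show ?case using Suc \<open>\<And>c. e (c + 1) = e c\<close> by metis
  qed simp
  have "depth L c = depth M c" for c
  proof -
    have "\<exists>u. \<forall>c'\<in>content ` (L \<union> M). c' \<le> u"
      using L(2) M(2) by (intro exI[of _ "Max (content ` (L \<union> M))"]) (auto intro!: Max_ge)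
    then obtain u where u: "\<And>b. b \<in> L \<union> M \<Longrightarrow> content b \<le> u" by auto
    \<comment> \<open>A diagonal to the right of both diagrams.\<close>
    define c' where "c' = c + int (nat (u + 1 - c))"
    have "c' > u" by (simp add: c'_def)
    then have "{t. diag c' t \<in> L} = {}" "{t. diag c' t \<in> M} = {}" using u content_diag by fastforce+
    then have "e c' = 0" by (simp add: e_def depth_def)
    then show ?thesis using e[of c "nat (u + 1 - c)"] by (simp add: c'_def e_def)
  qed
  then show ?thesis using mem_iff_depth[OF L] mem_iff_depth[OF M] by auto
qed

definition in_strip :: "int \<Rightarrow> nat \<Rightarrow> int \<Rightarrow> bool" where
  "in_strip x j c \<longleftrightarrow> x < c \<and> c \<le> x + int j"

text \<open>
  Lengthening a block of consecutive diagonals by one box changes the profile only at the two ends of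
  the block.
\<close>

lemma jump_add_strip:
  assumes "j > 0"
  shows "jump (\<lambda>c. D c + of_bool (in_strip x j c)) c = jump D c + of_bool (c = x) - of_bool (c = x + int j)"
  using assms by (auto simp: jump_def in_strip_def)

lemma skew_convex:
  assumes "lower L" "lower (L \<union> B)" "B \<inter> L = {}" "(i, j) \<in> B" "(i', j') \<in> B"
    and "i \<le> p" "p \<le> i'" "j \<le> q" "q \<le> j'"
  shows "(p, q) \<in> B"
proof -
  have "(p, q) \<in> L \<union> B" using lowerD[OF assms(2), of i' j' p q] assms by blast
  moreover have "(p, q) \<notin> L" using lowerD[OF assms(1), of p q i j] assms by blast
  ultimately show ?thesis by blast
qed

lemma adjacent_content: "adjacent b c \<Longrightarrow> content c = content b + 1 \<or> content c = content b - 1"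
  by (auto simp: adjacent_def content_def)

text \<open>
  Two boxes on the same diagonal would span, by convexity of a skew shape, a square of four boxes.
\<close>

lemma inj_on_content_strip:
  assumes "lower L" "lower (L \<union> B)" "B \<inter> L = {}" "border_strip B"
  shows "inj_on content B"
proof -
  have *: "i = i' \<and> j = j'" if b: "(i, j) \<in> B" "(i', j') \<in> B" "content (i, j) = content (i', j')" "i \<le> i'" for i j i' j'
  proof (rule ccontr)
    assume ne: "\<not> ?thesis"
    then have "Suc i \<le> i'" "Suc j \<le> j'" using b(3,4) by (auto simp: content_def)
    then have "{(i, j), (i, Suc j), (Suc i, j), (Suc i, Suc j)} \<subseteq> B"
      using skew_convex[OF assms(1-3) b(1,2)] by simp
    then show False using assms(4) unfolding border_strip_def by blast
  qed
  show ?thesis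
  proof (rule inj_onI)
    fix b c assume "b \<in> B" "c \<in> B" "content b = content c"
    then show "b = c" using *[of "fst b" "snd b" "fst c" "snd c"] *[of "fst c" "snd c" "fst b" "snd b"]
      by (cases "fst b \<le> fst c") (auto intro: prod_eqI)
  qed
qed

text \<open>
  Contents change by one along a path of adjacent boxes, so no value is skipped.
\<close>

lemma connected_contents:
  assumes "(b, b') \<in> {(x, y). x \<in> S \<and> y \<in> S \<and> adjacent x y}\<^sup>*" "b \<in> S" "content b \<le> c" "c \<le> content b'"
  shows "c \<in> content ` S"
  using assms
proof (induction rule: rtrancl_induct)
  case base
  then have "c = content b" by simp
  then show ?case using base by blast
next
  case (step y z)
  show ?case
  proof (cases "c \<le> content y")
    case False
    then have "c = content z" using step adjacent_content[of y z] by auto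
    then show ?thesis using step by auto
  qed (use step in blast)
qed

definition strip_start :: "box set \<Rightarrow> int" where
  "strip_start B = Min (content ` B) - 1"

lemma strip_contents:
  assumes "lower L" "lower (L \<union> B)" "B \<inter> L = {}" "border_strip B" "finite B"
  shows "bij_betw content B {c. in_strip (strip_start B) (card B) c}"
proof -
  let ?lo = "Min (content ` B)" and ?hi = "Max (content ` B)"
  have ne: "content ` B \<noteq> {}" "finite (content ` B)" using assms by (auto simp: border_strip_def)
  have im: "content ` B = {?lo..?hi}"
  proof
    show "content ` B \<subseteq> {?lo..?hi}" using ne by auto
    obtain b b' where b: "b \<in> B" "content b = ?lo" "b' \<in> B" "content b' = ?hi"
      using Min_in[OF ne(2,1)] Max_in[OF ne(2,1)] by (metis imageE)
    then have "(b, b') \<in> {(x, y). x \<in> B \<and> y \<in> B \<and> adjacent x y}\<^sup>*"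
      using assms(4) by (auto simp: border_strip_def connected_boxes_def)
    then show "{?lo..?hi} \<subseteq> content ` B" using connected_contents[of b b' B] b by auto
  qed
  have inj: "inj_on content B" by (rule inj_on_content_strip[OF assms(1-4)])
  have "?lo \<le> ?hi" using ne by simp
  moreover have "card B = card {?lo..?hi}" using card_image[OF inj] im by metis
  ultimately have "int (card B) = ?hi - ?lo + 1" by simp
  then have "{?lo..?hi} = {c. in_strip (strip_start B) (card B) c}"
    by (auto simp: in_strip_def strip_start_def)
  then show ?thesis using inj im by (simp add: bij_betw_def)
qed

text \<open>
  A strip has exactly one box on each of the diagonals that it meets.
\<close>

lemma depth_add_strip:
  assumes "finite L" "B \<inter> L = {}" "finite B" and bij: "bij_betw content B {c. in_strip x j c}"
  shows "depth (L \<union> B) c = depth L c + of_bool (in_strip x j c)"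
proof -
  have "{t. diag c t \<in> L \<union> B} = {t. diag c t \<in> L} \<union> {t. diag c t \<in> B}" by blast
  moreover have "card {t. diag c t \<in> B} = of_bool (in_strip x j c)"
  proof (cases "in_strip x j c")
    case True
    then obtain b where b: "b \<in> B" "content b = c" using bij unfolding bij_betw_def by (metis imageE mem_Collect_eq)
    have "{t. diag c t \<in> B} = {min (fst b) (snd b)}"
    proof -
      have "t = min (fst b) (snd b)" if "diag c t \<in> B" for t
      proof -
        have "diag c t = b" using bij that b by (simp add: bij_betw_def inj_on_def)
        then show ?thesis by (auto simp: diag_def min_def)
      qed
      moreover have "diag c (min (fst b) (snd b)) \<in> B" using diag_content[of b] b by metis
      ultimately show ?thesis by blast
    qed
    then show ?thesis using True by simp
  next
    case False
    then have "{t. diag c t \<in> B} = {}" using bij unfolding bij_betw_def by (metis (mono_tags) Collect_empty_eq content_diag imageI mem_Collect_eq)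
    then show ?thesis using False by simp
  qed
  moreover have "{t. diag c t \<in> L} \<inter> {t. diag c t \<in> B} = {}" using assms(2) by blast
  ultimately show ?thesis unfolding depth_def
    using card_Un_disjoint[OF finite_diag[OF assms(1)] finite_diag[OF assms(3)]] by metis
qed

lemma beads_add_strip:
  assumes "lower L" "finite L" "lower (L \<union> B)" "B \<inter> L = {}" "border_strip B" "finite B"
  shows "strip_start B \<in> beads L" "strip_start B + int (card B) \<notin> beads L"
    "beads (L \<union> B) = insert (strip_start B + int (card B)) (beads L - {strip_start B})"
proof -
  let ?x = "strip_start B" and ?j = "card B"
  have j: "?j > 0" using assms(5,6) by (auto simp: border_strip_def card_gt_0_iff)
  have "depth (L \<union> B) = (\<lambda>c. depth L c + of_bool (in_strip ?x ?j c))"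
    using depth_add_strip[OF assms(2,4,6) strip_contents[OF assms(1,3,4,5,6)]] by blast
  then have jump: "jump (depth (L \<union> B)) c = jump (depth L) c + of_bool (c = ?x) - of_bool (c = ?x + int ?j)" for c
    using jump_add_strip[OF j] by simp
  have 01: "jump (depth L) c \<in> {0, 1}" "jump (depth (L \<union> B)) c \<in> {0, 1}" for c
    using jump_depth assms by auto
  show 1: "?x \<in> beads L" using 01(1)[of ?x] 01(2)[of ?x] jump[of ?x] j by (auto simp: beads_def)
  have 2: "jump (depth L) (?x + int ?j) = 1"
    using 01(1)[of "?x + int ?j"] 01(2)[of "?x + int ?j"] jump[of "?x + int ?j"] j by auto
  then show "?x + int ?j \<notin> beads L" by (simp add: beads_def)
  show "beads (L \<union> B) = insert (?x + int ?j) (beads L - {?x})"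
    using jump 1 2 j by (auto simp: beads_def split: if_splits)
qed

text \<open>
  The strip consists of the first box outside \<open>L\<close> on each of the diagonals \<open>x + 1\<close> to
  \<open>x + j\<close>. The values of \<open>jump\<close> stay \<open>0\<close> or \<open>1\<close>, which says that the union
  is again a diagram, and that boxes on neighbouring diagonals are adjacent.
\<close>

lemma strip_exists:
  assumes L: "lower L" "finite L" and x: "x \<in> beads L" "x + int j \<notin> beads L" and j: "j > 0"
  shows "\<exists>B. B \<inter> L = {} \<and> lower (L \<union> B) \<and> border_strip B \<and> card B = j \<and> strip_start B = x"
proof -
  define cell where "cell c = diag c (depth L c)" for c
  define B where "B = cell ` {c. in_strip x j c}"
  define D where "D c = depth L c + of_bool (in_strip x j c)" for c
  have I: "{c. in_strip x j c} = {x + 1..x + int j}" by (auto simp: in_strip_def)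
  have cell [simp]: "content (cell c) = c" for c by (simp add: cell_def)
  have inj: "inj_on cell A" for A by (metis cell inj_onI)
  have finB: "finite B" unfolding B_def I by simp
  have cardB: "card B = j" unfolding B_def using card_image[OF inj] by (simp add: I)
  have imB: "content ` B = {x + 1..x + int j}" unfolding B_def I by (simp add: image_image)
  have start: "strip_start B = x"
  proof -
    have "Min {x + 1..x + int j} = x + 1" using j by (intro Min_eqI) auto
    then show ?thesis by (simp add: strip_start_def imB)
  qed
  have disj: "B \<inter> L = {}" using mem_depth[OF L] by (auto simp: B_def cell_def)
  have jumpD: "jump D c \<in> {0, 1}" for c
  proof -
    have "jump (depth L) x = 0" "jump (depth L) (x + int j) = 1"
      using x jump_depth[OF L, of "x + int j"] by (auto simp: beads_def)
    moreover have "jump D c = jump (depth L) c + of_bool (c = x) - of_bool (c = x + int j)"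
      unfolding D_def using jump_add_strip[OF j] by blast
    ultimately show ?thesis using jump_depth[OF L, of c] j by (auto split: if_splits)
  qed
  have mem: "b \<in> L \<union> B \<longleftrightarrow> min (fst b) (snd b) < D (content b)" for b
  proof -
    have "b \<in> B \<longleftrightarrow> in_strip x j (content b) \<and> min (fst b) (snd b) = depth L (content b)"
    proof -
      have "b \<in> B \<longleftrightarrow> in_strip x j (content b) \<and> b = cell (content b)" by (auto simp: B_def)
      also have "b = cell (content b) \<longleftrightarrow> min (fst b) (snd b) = depth L (content b)"
        using diag_content[of b] diag_inject unfolding cell_def by metis
      finally show ?thesis .
    qed
    then show ?thesis using mem_iff_depth[OF L, of b] by (auto simp: D_def)
  qed
  have low: "lower (L \<union> B)"
  proof (rule lowerI)
    fix i i' :: nat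
    define c where "c = content (i, i')"
    show "(i, i') \<in> L \<union> B" if *: "(Suc i, i') \<in> L \<union> B"
    proof -
      have "content (Suc i, i') = c - 1" by (simp add: content_def c_def)
      then have "min (Suc i) i' < D (c - 1)" using * mem[of "(Suc i, i')"] by simp
      moreover have "int (D c) - int (D (c - 1)) + of_bool (0 < c) \<in> {0, 1}"
        using jumpD[of "c - 1"] by (simp add: jump_def)
      moreover have "0 < c \<longleftrightarrow> i' \<ge> Suc i" by (auto simp: c_def content_def)
      ultimately show ?thesis using mem[of "(i, i')"] by (auto simp: c_def[symmetric] min_def split: if_splits)
    qed
    show "(i, i') \<in> L \<union> B" if *: "(i, Suc i') \<in> L \<union> B"
    proof -
      have "content (i, Suc i') = c + 1" by (simp add: content_def c_def)
      then have "min i (Suc i') < D (c + 1)" using * mem[of "(i, Suc i')"] by simp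
      moreover have "int (D (c + 1)) - int (D c) + of_bool (c \<ge> 0) \<in> {0, 1}"
        using jumpD[of c] by (simp add: jump_def)
      moreover have "c \<ge> 0 \<longleftrightarrow> i' \<ge> i" by (auto simp: c_def content_def)
      ultimately show ?thesis using mem[of "(i, i')"] by (auto simp: c_def[symmetric] min_def split: if_splits)
    qed
  qed
  have adj: "adjacent (cell c) (cell (c + 1))" for c
  proof -
    have "jump (depth L) c \<in> {0, 1}" by (rule jump_depth[OF L])
    then show ?thesis
      by (cases "c \<ge> 0") (auto simp: jump_def cell_def diag_def adjacent_def nat_add_distrib)
  qed
  let ?R = "{(b, b'). b \<in> B \<and> b' \<in> B \<and> adjacent b b'}"
  have path: "(cell (x + 1), cell (x + 1 + int i)) \<in> ?R\<^sup>*" if "i < j" for i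
    using that
  proof (induction i)
    case (Suc i)
    have "(cell (x + 1 + int i), cell (x + 1 + int i + 1)) \<in> ?R"
      using adj[of "x + 1 + int i"] Suc.prems unfolding B_def I by auto
    then have "(cell (x + 1), cell (x + 1 + int i + 1)) \<in> ?R\<^sup>*"
      using Suc by (meson Suc_lessD rtrancl.rtrancl_into_rtrancl)
    then show ?case by (simp add: algebra_simps)
  qed simp
  have "sym ?R" by (auto simp: sym_def adjacent_def)
  then have sym: "sym (?R\<^sup>*)" by (rule sym_rtrancl)
  have from_start: "(cell (x + 1), b) \<in> ?R\<^sup>*" if b: "b \<in> B" for b
  proof -
    have "b \<in> cell ` {x + 1..x + int j}" using b unfolding B_def I .
    then obtain c where c: "b = cell c" "c \<in> {x + 1..x + int j}" by blast
    define i where "i = nat (c - (x + 1))"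
    have "c = x + 1 + int i" "i < j" using c(2) by (auto simp: i_def)
    then show ?thesis using path[of i] c(1) by simp
  qed
  have "connected_boxes B"
    unfolding connected_boxes_def
  proof (intro ballI)
    fix b b' assume b: "b \<in> B" "b' \<in> B"
    have "(b, cell (x + 1)) \<in> ?R\<^sup>*" by (rule symD[OF sym from_start[OF b(1)]])
    then show "(b, b') \<in> ?R\<^sup>*" using from_start[OF b(2)] by (rule rtrancl_trans)
  qed
  moreover have "\<not> {(a, b), (a, Suc b), (Suc a, b), (Suc a, Suc b)} \<subseteq> B" for a b
  proof
    assume "{(a, b), (a, Suc b), (Suc a, b), (Suc a, Suc b)} \<subseteq> B"
    then obtain c c' where c: "(a, b) = cell c" "(Suc a, Suc b) = cell c'" by (auto simp: B_def)
    then have "c = content (a, b)" "c' = content (Suc a, Suc b)" using cell by metis+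
    then have "c = c'" by (simp add: content_def)
    then have "(a, b) = (Suc a, Suc b)" using c by metis
    then show False by simp
  qed
  moreover have "\<exists>lam mu. skew_shape lam mu \<and> B = skew_diagram lam mu"
  proof -
    obtain mu where mu: "is_partition mu" "young_diagram mu = L"
      using lower_is_young_diagram[OF L] by blast
    have "finite (L \<union> B)" using L(2) finB by simp
    then obtain lam where lam: "is_partition lam" "young_diagram lam = L \<union> B"
      using lower_is_young_diagram[OF low] by blast
    have "skew_shape lam mu" "B = skew_diagram lam mu"
      using mu lam disj unfolding skew_shape_def skew_diagram_def by auto
    then show ?thesis by blast
  qed
  moreover have "B \<noteq> {}" using cardB j by auto
  ultimately have "border_strip B" unfolding border_strip_def by blast
  then show ?thesis using disj low cardB start by blast
qed

text \<open>
  A tableau as a chain of diagrams: unlike a list of strips with a filling condition, this can be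
  followed one strip at a time.
\<close>

fun strips :: "nat \<Rightarrow> box set \<Rightarrow> box set list \<Rightarrow> box set \<Rightarrow> bool" where
  "strips j L [] M \<longleftrightarrow> L = M"
| "strips j L (B # Bs) M \<longleftrightarrow>
     B \<inter> L = {} \<and> lower (L \<union> B) \<and> border_strip B \<and> card B = j \<and> strips j (L \<union> B) Bs M"

lemma strips_slides:
  assumes "j > 0" "lower L" "finite L" "strips j L Bs M"
  shows "slides (int j) (beads L) (map strip_start Bs) (beads M)"
  using assms(2-4)
proof (induction Bs arbitrary: L)
  case (Cons B Bs)
  then have fin: "finite B" using card_ge_0_finite assms(1) by auto
  have B: "B \<inter> L = {}" "lower (L \<union> B)" "border_strip B" "card B = j" "strips j (L \<union> B) Bs M"
    using Cons.prems by auto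
  note b = beads_add_strip[OF Cons.prems(1,2) B(2,1,3) fin, unfolded B(4)]
  have "slides (int j) (beads (L \<union> B)) (map strip_start Bs) (beads M)"
    using Cons.IH[OF B(2) _ B(5)] Cons.prems(2) fin by simp
  then show ?case using b by simp
qed simp

lemma strips_inject:
  assumes "j > 0" "lower L" "finite L" "strips j L Bs M" "strips j L Bs' M'"
    and "map strip_start Bs = map strip_start Bs'"
  shows "Bs = Bs'"
  using assms(2-)
proof (induction Bs arbitrary: L Bs')
  case (Cons B Bs)
  then obtain B' Bs'' where Bs': "Bs' = B' # Bs''" by (cases Bs') auto
  have fin: "finite B" "finite B'" using card_ge_0_finite assms(1) Cons.prems Bs' by auto
  have B: "B \<inter> L = {}" "lower (L \<union> B)" "border_strip B" "card B = j" "strips j (L \<union> B) Bs M"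
    using Cons.prems by auto
  have B': "B' \<inter> L = {}" "lower (L \<union> B')" "border_strip B'" "card B' = j" "strips j (L \<union> B') Bs'' M'"
    using Cons.prems Bs' by auto
  have eq: "strip_start B = strip_start B'" "map strip_start Bs = map strip_start Bs''"
    using Cons.prems Bs' by auto
  have "beads (L \<union> B) = beads (L \<union> B')"
    using beads_add_strip(3)[OF Cons.prems(1,2) B(2,1,3) fin(1)]
      beads_add_strip(3)[OF Cons.prems(1,2) B'(2,1,3) fin(2)] B(4) B'(4) eq(1) by simp
  then have "L \<union> B = L \<union> B'"
    using beads_inject[OF B(2) _ B'(2)] Cons.prems(2) fin by simp
  then have BB: "B = B'" using B(1) B'(1) by blast
  then have "Bs = Bs''"
    using Cons.IH[OF B(2) _ B(5) _ eq(2)] B'(5) Cons.prems(2) fin by simp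
  then show ?case using BB Bs' by simp
qed simp

lemma slides_strips:
  assumes "j > 0" "lower L" "finite L" "lower M" "finite M" "slides (int j) (beads L) w (beads M)"
  shows "\<exists>Bs. strips j L Bs M \<and> map strip_start Bs = w"
  using assms(2,3,6)
proof (induction w arbitrary: L)
  case Nil
  then have "L = M" using beads_inject assms(4,5) by simp
  then show ?case by (intro exI[of _ "[]"]) simp
next
  case (Cons x w)
  then have x: "x \<in> beads L" "x + int j \<notin> beads L"
    and w: "slides (int j) (insert (x + int j) (beads L - {x})) w (beads M)" by auto
  obtain B where B: "B \<inter> L = {}" "lower (L \<union> B)" "border_strip B" "card B = j" "strip_start B = x"
    using strip_exists[OF Cons.prems(1,2) x assms(1)] by blast
  have fin: "finite B" using card_ge_0_finite assms(1) B(4) by auto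
  have "beads (L \<union> B) = insert (x + int j) (beads L - {x})"
    using beads_add_strip(3)[OF Cons.prems(1,2) B(2,1,3) fin] B by simp
  then obtain Bs where "strips j (L \<union> B) Bs M" "map strip_start Bs = w"
    using Cons.IH[OF B(2)] Cons.prems(2) fin w by auto
  then show ?case using B by (intro exI[of _ "B # Bs"]) auto
qed

lemma bij_betw_strips_slides:
  assumes "j > 0" "lower L" "finite L" "lower M" "finite M"
  shows "bij_betw (map strip_start) {Bs. strips j L Bs M} {w. slides (int j) (beads L) w (beads M)}"
  unfolding bij_betw_def
proof
  show "inj_on (map strip_start) {Bs. strips j L Bs M}"
    using strips_inject[OF assms(1-3)] by (auto simp: inj_on_def)
  show "map strip_start ` {Bs. strips j L Bs M} = {w. slides (int j) (beads L) w (beads M)}"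
    using strips_slides[OF assms(1-3)] slides_strips[OF assms] by blast
qed

lemma strips_iff:
  "strips j L Bs M \<longleftrightarrow> M = L \<union> \<Union> (set Bs) \<and>
     (\<forall>i<length Bs. Bs ! i \<inter> (L \<union> \<Union> (set (take i Bs))) = {} \<and>
        lower (L \<union> \<Union> (set (take (Suc i) Bs))) \<and> border_strip (Bs ! i) \<and> card (Bs ! i) = j)"
proof (induction Bs arbitrary: L)
  case (Cons B Bs)
  have split: "(\<forall>i<Suc n. P i) \<longleftrightarrow> P 0 \<and> (\<forall>i<n. P (Suc i))" for P n by (rule All_less_Suc2)
  show ?case unfolding length_Cons split strips.simps Cons.IH
    by (simp add: Un_assoc) blast
qed auto

lemma strip_label_eq:
  assumes disj: "\<And>i i'. i < i' \<Longrightarrow> i' < length Bs \<Longrightarrow> Bs ! i \<inter> Bs ! i' = {}"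
    and "l < length Bs" "b \<in> Bs ! l"
  shows "strip_label Bs b = Suc l"
  unfolding strip_label_def
proof (rule the_equality)
  show "1 \<le> Suc l \<and> Suc l \<le> length Bs \<and> b \<in> Bs ! (Suc l - 1)" using assms by simp
  fix j assume j: "1 \<le> j \<and> j \<le> length Bs \<and> b \<in> Bs ! (j - 1)"
  then have "j - 1 < length Bs" by linarith
  then have "j - 1 = l"
    using disj[of "j - 1" l] disj[of l "j - 1"] assms(2,3) j by (meson disjoint_iff linorder_neqE_nat)
  then show "j = Suc l" using j by linarith
qed

text \<open>
  The filling increases weakly if and only if the boxes with label at most \<open>i\<close>, together with the
  inner diagram, form a diagram for every \<open>i\<close>.
\<close>

lemma BST_eq_strips:
  assumes shape: "skew_shape lam mu"
  shows "BST lam mu d = {Bs. strips d (young_diagram mu) Bs (young_diagram lam)}"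
proof (intro set_eqI iffI; unfold mem_Collect_eq)
  let ?L = "young_diagram mu" and ?M = "young_diagram lam"
  have low: "lower ?L" "lower ?M" and sub: "?L \<subseteq> ?M"
    using shape lower_young_diagram by (auto simp: skew_shape_def)
  fix Bs
  {
    assume "Bs \<in> BST lam mu d"
    then have dist: "distinct Bs" and part: "partition_on (?M - ?L) (set Bs)"
      and bs: "\<And>B. B \<in> set Bs \<Longrightarrow> border_strip B \<and> card B = d"
      and weak: "weakly_increasing_filling (?M - ?L) (strip_label Bs)"
      by (auto simp: BST_def skew_diagram_def)
    have un: "\<Union> (set Bs) = ?M - ?L" using part by (simp add: partition_on_def)
    have disj: "Bs ! i \<inter> Bs ! i' = {}" if "i < i'" "i' < length Bs" for i i'
      using part dist that unfolding partition_on_def disjoint_def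
      by (metis nat_neq_iff nth_eq_iff_index_eq nth_mem order.strict_trans)
    have label: "strip_label Bs b = Suc l" if "l < length Bs" "b \<in> Bs ! l" for l b
      using strip_label_eq[OF disj that] .
    have lower: "lower (?L \<union> \<Union> (set (take (Suc i) Bs)))" if i: "i < length Bs" for i
      unfolding lower_def
    proof (intro allI impI)
      fix a b a' b' assume ab: "(a, b) \<in> ?L \<union> \<Union> (set (take (Suc i) Bs))" "a' \<le> a" "b' \<le> b"
      show "(a', b') \<in> ?L \<union> \<Union> (set (take (Suc i) Bs))"
      proof (cases "(a', b') \<in> ?L")
        case False
        then have "(a, b) \<notin> ?L" "(a', b) \<notin> ?L" using lowerD[OF low(1)] ab(2,3) by blast+
        then obtain B where B: "B \<in> set (take (Suc i) Bs)" "(a, b) \<in> B" using ab(1) by blast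
        then obtain l where l: "l < length Bs" "l \<le> i" "(a, b) \<in> Bs ! l"
          unfolding in_set_conv_nth by auto
        then have "(a, b) \<in> ?M - ?L" using un nth_mem by blast
        then have in_D: "(a, b) \<in> ?M - ?L" "(a', b) \<in> ?M - ?L" "(a', b') \<in> ?M - ?L"
          using lowerD[OF low(2)] ab(2,3) False \<open>(a', b) \<notin> ?L\<close> by blast+
        obtain l' where l': "l' < length Bs" "(a', b') \<in> Bs ! l'"
          using in_D(3) un by (metis UnionE in_set_conv_nth)
        have "strip_label Bs (a', b') \<le> strip_label Bs (a', b)"
          using weak in_D ab(3) unfolding weakly_increasing_filling_def by blast
        also have "\<dots> \<le> strip_label Bs (a, b)"
          using weak in_D ab(2) unfolding weakly_increasing_filling_def by blast
        finally have "l' \<le> l" using label l l' by simp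
        then have "Bs ! l' \<in> set (take (Suc i) Bs)"
          using l l' unfolding in_set_conv_nth by (intro exI[of _ l']) auto
        then show ?thesis using l'(2) by blast
      qed simp
    qed
    have new: "Bs ! i \<inter> (?L \<union> \<Union> (set (take i Bs))) = {}" if i: "i < length Bs" for i
    proof -
      have "Bs ! i \<inter> B = {}" if B: "B \<in> set (take i Bs)" for B
      proof -
        obtain l where "l < i" "B = Bs ! l" using B i by (auto simp: in_set_conv_nth)
        then show ?thesis using disj[of l i] i by blast
      qed
      moreover have "Bs ! i \<subseteq> ?M - ?L" using un i nth_mem by blast
      ultimately show ?thesis by blast
    qed
    show "strips d ?L Bs ?M"
      unfolding strips_iff using un sub lower new bs nth_mem by blast
  next
    assume "strips d ?L Bs ?M"
    then have un: "?M = ?L \<union> \<Union> (set Bs)"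
      and new: "\<And>i. i < length Bs \<Longrightarrow> Bs ! i \<inter> (?L \<union> \<Union> (set (take i Bs))) = {}"
      and lower: "\<And>i. i < length Bs \<Longrightarrow> lower (?L \<union> \<Union> (set (take (Suc i) Bs)))"
      and bs: "\<And>i. i < length Bs \<Longrightarrow> border_strip (Bs ! i) \<and> card (Bs ! i) = d"
      unfolding strips_iff by blast+
    have nonempty: "Bs ! i \<noteq> {}" if "i < length Bs" for i
      using bs[OF that] by (simp add: border_strip_def)
    have disj: "Bs ! i \<inter> Bs ! i' = {}" if "i < i'" "i' < length Bs" for i i'
    proof -
      have "Bs ! i \<in> set (take i' Bs)" using that unfolding in_set_conv_nth by (intro exI[of _ i]) auto
      then show ?thesis using new[OF that(2)] by blast
    qed
    have away: "Bs ! i \<inter> ?L = {}" if "i < length Bs" for i using new[OF that] by blast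
    have dist: "distinct Bs"
      unfolding distinct_conv_nth using disj nonempty by (metis Int_absorb nat_neq_iff)
    have D: "?M - ?L = \<Union> (set Bs)" using un away by (force simp: in_set_conv_nth)
    have "partition_on (?M - ?L) (set Bs)"
      unfolding partition_on_def disjoint_def
    proof (intro conjI ballI impI)
      show "\<Union> (set Bs) = ?M - ?L" using D by simp
      show "{} \<notin> set Bs" using nonempty by (metis in_set_conv_nth)
      fix B B' assume "B \<in> set Bs" "B' \<in> set Bs" "B \<noteq> B'"
      then show "B \<inter> B' = {}" using disj by (metis in_set_conv_nth inf_commute nat_neq_iff)
    qed
    moreover have "weakly_increasing_filling (?M - ?L) (strip_label Bs)"
    proof -
      have le: "strip_label Bs (a', b') \<le> strip_label Bs (a, b)"
        if D1: "(a', b') \<in> ?M - ?L" and D2: "(a, b) \<in> ?M - ?L" and ab: "a' \<le> a" "b' \<le> b" for a b a' b'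
      proof -
        obtain l where l: "l < length Bs" "(a, b) \<in> Bs ! l" using D2 unfolding D by (metis UnionE in_set_conv_nth)
        have "Bs ! l \<in> set (take (Suc l) Bs)" using l(1) by (simp add: take_Suc_conv_app_nth)
        then have "(a', b') \<in> ?L \<union> \<Union> (set (take (Suc l) Bs))"
          using lowerD[OF lower[OF l(1)], of a b a' b'] l(2) ab by blast
        then obtain B where "B \<in> set (take (Suc l) Bs)" "(a', b') \<in> B" using D1 by blast
        then obtain l' where l': "l' < length Bs" "l' \<le> l" "(a', b') \<in> Bs ! l'"
          unfolding in_set_conv_nth by auto
        show ?thesis using strip_label_eq[OF disj l] strip_label_eq[OF disj l'(1,3)] l'(2) by simp
      qed
      then show ?thesis unfolding weakly_increasing_filling_def by blast
    qed
    moreover have "\<forall>B\<in>set Bs. border_strip B \<and> card B = d" using bs by (metis in_set_conv_nth)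
    ultimately show "Bs \<in> BST lam mu d" using dist by (simp add: BST_def skew_diagram_def)
  }
qed

lemma card_BST:
  assumes "skew_shape lam mu" "d > 0"
  shows "card (BST lam mu d) =
    card {w. slides (int d) (beads (young_diagram mu)) w (beads (young_diagram lam))}"
  using bij_betw_same_card[OF bij_betw_strips_slides[OF assms(2)]] BST_eq_strips[OF assms(1), of d]
    assms(1) lower_young_diagram finite_young_diagram by (simp add: skew_shape_def)

lemma finite_slides_beads:
  assumes "skew_shape lam mu" "d > 0"
  shows "finite {w. slides (int d) (beads (young_diagram mu)) w (beads (young_diagram lam))}"
proof -
  have "bij_betw (map strip_start) (BST lam mu d)
      {w. slides (int d) (beads (young_diagram mu)) w (beads (young_diagram lam))}"
    unfolding BST_eq_strips[OF assms(1)]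
    using bij_betw_strips_slides[OF assms(2)] assms(1) lower_young_diagram finite_young_diagram
    by (simp add: skew_shape_def)
  then show ?thesis using finite_BST bij_betw_finite by blast
qed

section \<open>Counting by decodable words\<close>

text \<open>
  The relation \<open>code\<close> plays the role of an injection of the disjoint union of the sets \<open>V d\<close>;
  nothing has to be chosen, it only has to be decodable.
\<close>

lemma sum_card_le_by_codes:
  assumes "finite W"
    and ex: "\<And>d v. d \<in> D \<Longrightarrow> v \<in> V d \<Longrightarrow> \<exists>U\<in>W. code d v U"
    and un: "\<And>d v d' v' U. d \<in> D \<Longrightarrow> d' \<in> D \<Longrightarrow> code d v U \<Longrightarrow> code d' v' U \<Longrightarrow> d = d' \<and> v = v'"
  shows "(\<Sum>d\<in>D. card (V d)) \<le> card W"
proof (cases "finite D")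
  case True
  obtain f where f: "\<And>p. p \<in> Sigma D V \<Longrightarrow> f p \<in> W \<and> code (fst p) (snd p) (f p)"
  proof -
    have "\<forall>p\<in>Sigma D V. \<exists>U. U \<in> W \<and> code (fst p) (snd p) U" using ex by fastforce
    then show ?thesis using that by (metis bchoice)
  qed
  have inj: "inj_on f (Sigma D V)"
  proof (rule inj_onI)
    fix p q assume pq: "p \<in> Sigma D V" "q \<in> Sigma D V" "f p = f q"
    then have "code (fst p) (snd p) (f p)" "code (fst q) (snd q) (f p)" using f by metis+
    then show "p = q" using un[of "fst p" "fst q"] pq by (auto intro: prod_eqI)
  qed
  have im: "f ` Sigma D V \<subseteq> W" using f by blast
  have fin: "finite (Sigma D V)" using inj im \<open>finite W\<close> by (rule inj_on_finite)
  have "finite (V d)" if "d \<in> D" for d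
  proof -
    have "V d \<subseteq> snd ` Sigma D V" using that by force
    then show ?thesis using fin finite_subset by blast
  qed
  then have "(\<Sum>d\<in>D. card (V d)) = card (Sigma D V)" using True by simp
  also have "\<dots> \<le> card W" using inj im \<open>finite W\<close> by (rule card_inj_on_le)
  finally show ?thesis .
qed simp

section \<open>Words with two different initial letters\<close>

text \<open>
  These letters are the minimal elements of the order in which moves are forced to occur.
\<close>

definition initial_letter :: "int \<Rightarrow> int set \<Rightarrow> int set \<Rightarrow> int \<Rightarrow> bool" where
  "initial_letter k X Y y \<longleftrightarrow> (\<exists>w. slides k X (y # w) Y)"

text \<open>
  A bead that can move at the beginning keeps its neighbours from moving until it has moved itself.
\<close>

lemma initial_letter_free:
  assumes "k > 0" "initial_letter k X Y y" "slides k X (us @ vs) Y" "y \<notin> set us" "u \<in> set us"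
  shows "\<not> adj k u y"
proof -
  have "y \<in> X" "y + k \<notin> X" using assms(2) by (auto simp: initial_letter_def)
  moreover obtain Z where "slides k X us Z" using assms(3) slides_append by blast
  ultimately show ?thesis using slides_first_letter_free assms by blast
qed

lemma initial_letter_occurs:
  assumes "k > 0" "initial_letter k X Y y" "slides k X w Y"
  shows "y \<in> set w"
proof -
  obtain w' where "slides k X (y # w') Y" using assms(2) by (auto simp: initial_letter_def)
  then have "mset w = mset (y # w')" using slides_mset assms by blast
  then show ?thesis by (metis list.set_intros(1) set_mset_mset)
qed

lemma split_first_block:
  assumes "slides k X T Y" "refines k d T v" "d > 0" "k > 0" "T \<noteq> []"
  obtains t r where "T = t @ r" "length t = d" "set t = blk k d (v ! 0)" "distinct t" "v \<noteq> []"
  using refines_first_block[OF assms(2,3,4,5)] append_take_drop_id[of d T] that by metis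

text \<open>
  The first block contains only one initial letter, and \<open>y\<close> is slid to the place behind that block.
  So the second initial letter of \<open>U\<close> sits at index \<open>d\<close>.
\<close>

definition code_lone :: "int \<Rightarrow> int set \<Rightarrow> int set \<Rightarrow> nat \<Rightarrow> int list \<Rightarrow> int list \<Rightarrow> bool" where
  "code_lone k X Y d v U \<longleftrightarrow> (\<exists>t us y vs. U = t @ y # us @ vs \<and> length t = d
     \<and> initial_letter k X Y y \<and> y \<noteq> hd t \<and> (\<forall>c\<in>set t. initial_letter k X Y c \<longrightarrow> c = hd t)
     \<and> (\<forall>u\<in>set us. \<not> adj k u y) \<and> refines k d (t @ us @ y # vs) v)"

text \<open>
  Here the second initial letter of \<open>U\<close> sits at index \<open>1\<close>, and \<open>d\<close> is the least
  length \<open>p \<ge> 2\<close> of a prefix that forms a progression.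
\<close>

definition code_pair :: "int \<Rightarrow> int set \<Rightarrow> int set \<Rightarrow> nat \<Rightarrow> int list \<Rightarrow> int list \<Rightarrow> bool" where
  "code_pair k X Y d v U \<longleftrightarrow> initial_letter k X Y (U ! 1) \<and> U ! 1 \<noteq> U ! 0 \<and> refines k d U v \<and> U \<noteq> []
     \<and> (\<forall>p c. 2 \<le> p \<and> p < d \<longrightarrow> set (take p U) \<noteq> blk k p c)"

lemma code_lone_unique:
  assumes k: "k > 0" and d: "d \<ge> 2" "d' \<ge> 2"
    and c: "code_lone k X Y d v U" "code_lone k X Y d' v' U"
  shows "d = d' \<and> v = v'"
proof -
  obtain t us y vs where U: "U = t @ y # us @ vs" "length t = d" "initial_letter k X Y y" "y \<noteq> hd t"
    "\<forall>c\<in>set t. initial_letter k X Y c \<longrightarrow> c = hd t" "\<forall>u\<in>set us. \<not> adj k u y" "refines k d (t @ us @ y # vs) v"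
    using c(1) unfolding code_lone_def by blast
  obtain t' us' y' vs' where U': "U = t' @ y' # us' @ vs'" "length t' = d'" "initial_letter k X Y y'" "y' \<noteq> hd t'"
    "\<forall>c\<in>set t'. initial_letter k X Y c \<longrightarrow> c = hd t'" "\<forall>u\<in>set us'. \<not> adj k u y'" "refines k d' (t' @ us' @ y' # vs') v'"
    using c(2) unfolding code_lone_def by blast
  have nth: "U ! d = y" "U ! d' = y'" using U U' by (metis nth_append_length)+
  have hd: "hd t = hd U" "hd t' = hd U" using U(1,2) U'(1,2) d by (cases t; cases t'; auto)+
  have "\<not> d < d'"
  proof
    assume "d < d'"
    then have "y \<in> set t'" using nth(1) U'(1,2) by (metis nth_append nth_mem)
    then show False using U U' hd by metis
  qed
  moreover have "\<not> d' < d"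
  proof
    assume "d' < d"
    then have "y' \<in> set t" using nth(2) U(1,2) by (metis nth_append nth_mem)
    then show False using U U' hd by metis
  qed
  ultimately have dd: "d = d'" by simp
  then have "t = t'" "y = y'" "us @ vs = us' @ vs'" using U(1,2) U'(1,2) by auto
  then have "v = v'"
    using refines_moved_letter[OF k d(1) U(2) U(7), of us' vs' v'] U U' dd by auto
  then show ?thesis using dd by simp
qed

lemma code_pair_unique:
  assumes k: "k > 0" and d: "d \<ge> 2" "d' \<ge> 2"
    and c: "code_pair k X Y d v U" "code_pair k X Y d' v' U"
  shows "d = d' \<and> v = v'"
proof -
  have r: "refines k d U v" "refines k d' U v'" "U \<noteq> []" using c by (auto simp: code_pair_def)
  have "set (take d U) = blk k d (v ! 0)" "set (take d' U) = blk k d' (v' ! 0)"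
    using refines_first_block(2)[OF r(1) _ k r(3)] refines_first_block(2)[OF r(2) _ k r(3)] d by auto
  then have "\<not> d < d'" "\<not> d' < d" using c d unfolding code_pair_def by metis+
  then have dd: "d = d'" by simp
  have "v = v'" by (rule refines_unique[OF k _ r(1) r(2)[folded dd]]) (use d in auto)
  then show ?thesis using dd by simp
qed

lemma code_lone_pair_disjoint:
  assumes "d \<ge> 2" "d' \<ge> 2" "code_lone k X Y d v U" "code_pair k X Y d' v' U"
  shows False
proof -
  obtain t r where U: "U = t @ r" "length t = d" "\<forall>c\<in>set t. initial_letter k X Y c \<longrightarrow> c = hd t"
    using assms(3) unfolding code_lone_def by blast
  then have "U ! 1 \<in> set t" "hd t = U ! 0" using assms(1) by (cases t; auto simp: nth_append)+
  then show False using U assms(4) unfolding code_pair_def by metis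
qed

text \<open>
  Two initial letters \<open>a\<close> and \<open>b\<close> of the first block are not adjacent, so some letter of the
  block lies strictly between them. The last such letter \<open>z\<close> comes after both of its neighbours
  and can be slid to the end of the block, while \<open>a\<close> and \<open>b\<close> are slid to the front. A
  shorter prefix contains \<open>a\<close> and \<open>b\<close> but not \<open>z\<close>.
\<close>

lemma code_pair_exists:
  assumes k: "k > 0" and d: "d \<ge> 2" and T: "slides k X T Y" "refines k d T v" "T \<noteq> []"
    and b: "b \<in> set (take d T)" "initial_letter k X Y b" "b \<noteq> hd T"
  shows "\<exists>U. slides k X U Y \<and> code_pair k X Y d v U"
proof -
  have d0: "d > 0" using d by simp
  obtain t r where t: "T = t @ r" "length t = d" "set t = blk k d (v ! 0)" "distinct t"
    using split_first_block[OF T(1,2) d0 k T(3)] .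
  obtain a t0 where a: "t = a # t0" using t(2) d by (cases t) auto
  have "take d T = t" "hd T = a" using t(1,2) a by auto
  then have "b \<in> set t0" "b \<noteq> a" using b(1,3) a by auto
  then obtain us vs where us: "t0 = us @ b # vs" "b \<notin> set us" by (meson split_list_first)
  have T1: "slides k X ((a # us) @ b # vs @ r) Y" using T(1) t(1) a us by simp
  have na: "\<not> adj k u b" if "u \<in> set (a # us)" for u
    by (rule initial_letter_free[OF k b(2) T1 _ that]) (use us \<open>b \<noteq> a\<close> in auto)
  have T2: "slides k X ([a] @ b # us @ (vs @ r)) Y"
    by (rule slides_pull) (use T1 na in auto)
  \<comment> \<open>The order of the two positions is unknown, and the letters between them are needed.\<close>
  define lo hi where "lo = min a b" and "hi = max a b"
  let ?Z = "\<lambda>c. lo < c \<and> c < hi"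
  have ab: "a \<in> set t" "b \<in> set t" using a us by auto
  have "lo \<in> blk k d (v ! 0)" "hi \<in> blk k d (v ! 0)"
    using ab unfolding lo_def hi_def min_def max_def t(3)[symmetric] by auto
  then obtain i j where i: "i < d" "lo = v ! 0 + int i * k" and j: "j < d" "hi = v ! 0 + int j * k"
    unfolding mem_blk by blast
  have lohi: "lo < hi" using \<open>b \<noteq> a\<close> by (auto simp: lo_def hi_def)
  have nadj: "hi \<noteq> lo + k" using na[of a] \<open>b \<noteq> a\<close> by (auto simp: lo_def hi_def adj_def)
  have ij: "int i < int j" using lohi i j k by auto
  have "j \<noteq> Suc i" using nadj i j by (auto simp: algebra_simps)
  then have ij2: "Suc i < j" using ij by simp
  have sett: "set (us @ vs) = set t - {a, b}" using t(4) a us by auto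
  have "lo + k \<in> set (us @ vs)"
  proof -
    have "lo + k = v ! 0 + int (Suc i) * k" using i by (simp add: algebra_simps)
    then have "lo + k \<in> set t" unfolding t(3) mem_blk using ij2 j by (intro exI[of _ "Suc i"]) auto
    moreover have "lo + k < hi" using \<open>lo + k = _\<close> j ij2 k by auto
    ultimately show ?thesis unfolding sett using k by (auto simp: lo_def hi_def)
  qed
  moreover have "lo + k < hi"
  proof -
    have "lo + k = v ! 0 + int (Suc i) * k" using i by (simp add: algebra_simps)
    then show ?thesis using j ij2 k by auto
  qed
  ultimately have "\<exists>c\<in>set (us @ vs). ?Z c" using k by (intro bexI[of _ "lo + k"]) auto
  then obtain r1 z r2 where z: "us @ vs = r1 @ z # r2" "?Z z" "\<And>c. c \<in> set r2 \<Longrightarrow> \<not> ?Z c"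
    using split_list_last_prop[of "us @ vs" ?Z] by blast
  have dis: "distinct (us @ vs)" using t(4) a us by auto
  have nz: "\<not> adj k u z" if u: "u \<in> set r2" for u
  proof
    assume "adj k u z"
    then have uz: "u = z + k \<or> u = z - k" by (auto simp: adj_def)
    have ut: "u \<in> set t" "u \<noteq> a" "u \<noteq> b" using u z(1) sett by auto
    have zt: "z \<in> set t" using z(1) sett by auto
    obtain l where l: "l < d" "z = v ! 0 + int l * k" using zt t(3) by (auto simp: mem_blk)
    have "int i < int l" "int l < int j" using z(2) l i j k by auto
    then have "int (Suc i) * k \<le> int l * k" "int (Suc l) * k \<le> int j * k" using k by (auto intro!: mult_right_mono)
    then have "lo \<le> z - k" "z + k \<le> hi" using l i j by (auto simp: algebra_simps)
    then have "?Z u \<or> u = lo \<or> u = hi" using uz z(2) k by auto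
    then show False using z(3)[OF u] ut by (auto simp: lo_def hi_def min_def max_def split: if_splits)
  qed
  let ?t = "a # b # r1 @ r2 @ [z]"
  have "[a] @ b # us @ vs @ r = (a # b # r1) @ z # r2 @ r"
    using arg_cong[OF z(1), of "\<lambda>l. l @ r"] by simp
  then have "slides k X ((a # b # r1) @ z # r2 @ r) Y" using T2 by metis
  then have U: "slides k X ((a # b # r1) @ r2 @ z # r) Y"
    by (rule slides_push) (rule nz)
  have len: "length ?t = d" using t(2) a us arg_cong[OF z(1), of length] by simp
  have st: "set ?t = set t" using arg_cong[OF z(1), of set] a us by auto
  have ref: "refines k d (?t @ r) v"
    using refines_replace[of k d "[]" t r v ?t 0] T(2) t len st d by simp
  have "set (take p (?t @ r)) \<noteq> blk k p c" if p: "2 \<le> p" "p < d" for p c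
  proof
    assume *: "set (take p (?t @ r)) = blk k p c"
    have tk: "take p (?t @ r) = a # b # take (p - 2) (r1 @ r2)"
      using p len by (auto simp: take_Cons' numeral_2_eq_2)
    have "a \<in> blk k p c" "b \<in> blk k p c" using * tk by auto
    then have "lo \<in> blk k p c" "hi \<in> blk k p c" by (auto simp: lo_def hi_def min_def max_def)
    moreover have "k dvd z - lo"
    proof -
      have "z \<in> set t" using z(1) sett by auto
      then obtain l where "z = v ! 0 + int l * k" using t(3) by (auto simp: mem_blk)
      then have "z - lo = (int l - int i) * k" using i by (simp add: algebra_simps)
      then show ?thesis by simp
    qed
    ultimately have "z \<in> blk k p c" using blk_convex[of lo k p c hi z] z(2) k by auto
    then have "z \<in> set (a # b # take (p - 2) (r1 @ r2))" using * tk by metis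
    then have "z = a \<or> z = b \<or> z \<in> set (r1 @ r2)"
      using in_set_takeD[of z "p - 2" "r1 @ r2"] unfolding list.set by blast
    moreover have "z \<noteq> a" "z \<noteq> b" using z(2) by (auto simp: lo_def hi_def)
    moreover have "z \<notin> set (r1 @ r2)" using dis[unfolded z(1)] by simp
    ultimately show False by blast
  qed
  then have "code_pair k X Y d v (?t @ r)" using b(2) \<open>b \<noteq> a\<close> ref by (simp add: code_pair_def)
  then show ?thesis using U by (intro exI[of _ "?t @ r"]) auto
qed

lemma code_lone_exists:
  assumes k: "k > 0" and d: "d \<ge> 2" and T: "slides k X T Y" "refines k d T v" "T \<noteq> []"
    and lone: "\<And>c. c \<in> set (take d T) \<Longrightarrow> initial_letter k X Y c \<Longrightarrow> c = hd T"
    and y: "initial_letter k X Y y" "y \<noteq> hd T"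
  shows "\<exists>U. slides k X U Y \<and> code_lone k X Y d v U"
proof -
  have d0: "d > 0" using d by simp
  obtain t r where t: "T = t @ r" "length t = d"
    using split_first_block[OF T(1,2) d0 k T(3)] .
  have hdt: "hd t = hd T" using t d by (cases t) auto
  let ?P = "\<lambda>c. initial_letter k X Y c \<and> c \<noteq> hd T"
  have "y \<in> set T" using initial_letter_occurs k y T by blast
  then have "y \<in> set r" using lone[of y] y t by auto
  then obtain us z vs where z: "r = us @ z # vs" "?P z" "\<And>c. c \<in> set us \<Longrightarrow> \<not> ?P c"
    using split_list_first_prop[of r ?P] y by blast
  have T': "slides k X ((t @ us) @ z # vs) Y" using T t z by simp
  have "z \<notin> set t" using lone[of z] z(2) t by auto
  then have na: "\<not> adj k u z" if "u \<in> set us" for u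
    by (intro initial_letter_free[OF k _ T']) (use z that in auto)
  have "slides k X (t @ z # us @ vs) Y" by (rule slides_pull) (use T' na in auto)
  moreover have "code_lone k X Y d v (t @ z # us @ vs)"
    unfolding code_lone_def using t z na T(2) lone hdt
    by (intro exI[of _ t] exI[of _ us] exI[of _ z] exI[of _ vs]) auto
  ultimately show ?thesis by blast
qed

lemma sum_le_two_initial_letters:
  assumes k: "k > 0" and fin: "finite {w. slides k X w Y}" and D: "\<And>d. d \<in> D \<Longrightarrow> d \<ge> 2"
    and ab: "initial_letter k X Y a" "initial_letter k X Y b" "a \<noteq> b"
  shows "(\<Sum>d\<in>D. card {v. slides (int d * k) X v Y}) \<le> card {w. slides k X w Y}"
proof (rule sum_card_le_by_codes[where code = "\<lambda>d v U. code_lone k X Y d v U \<or> code_pair k X Y d v U", OF fin])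
  fix d v assume d: "d \<in> D" and v: "v \<in> {v. slides (int d * k) X v Y}"
  obtain T where T: "slides k X T Y" "refines k d T v"
    using slides_refine[OF k _ , of d X v Y] D[OF d] v by auto
  have ne: "T \<noteq> []" using initial_letter_occurs[OF k ab(1) T(1)] by auto
  obtain y where y: "initial_letter k X Y y" "y \<noteq> hd T" using ab by metis
  show "\<exists>U\<in>{w. slides k X w Y}. code_lone k X Y d v U \<or> code_pair k X Y d v U"
  proof (cases "\<exists>c\<in>set (take d T). initial_letter k X Y c \<and> c \<noteq> hd T")
    case True
    then show ?thesis using code_pair_exists[OF k D[OF d] T ne] by blast
  next
    case False
    then show ?thesis using code_lone_exists[OF k D[OF d] T ne _ y] by blast
  qed
next
  fix d v d' v' U
  assume "d \<in> D" "d' \<in> D"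
  then have d: "d \<ge> 2" "d' \<ge> 2" using D by auto
  assume "code_lone k X Y d v U \<or> code_pair k X Y d v U"
    "code_lone k X Y d' v' U \<or> code_pair k X Y d' v' U"
  then show "d = d' \<and> v = v'"
    using code_lone_unique[OF k d, of X Y v U v'] code_pair_unique[OF k d, of X Y v U v']
      code_lone_pair_disjoint[OF d, of k X Y v U v'] code_lone_pair_disjoint[OF d(2,1), of k X Y v' U v]
    by argo
qed

section \<open>Words with a common first and a common last letter\<close>

(* From here on words are rearranged as wholes; taking them apart letter by letter would destroy the
  shape that the rules for sliding expect. *)
declare slides.simps(2) [simp del]

lemma split_at_first_eq:
  "xs @ x # ys = xs' @ x # ys' \<Longrightarrow> x \<notin> set xs \<Longrightarrow> x \<notin> set xs' \<Longrightarrow> xs = xs' \<and> ys = ys'"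
proof (induction xs arbitrary: xs')
  case Nil
  then show ?case by (cases xs') auto
next
  case (Cons a xs)
  then show ?case by (cases xs') auto
qed

text \<open>
  In terms of diagrams, a single component of the \<open>k\<close>-quotient is not empty, and it is a rectangle
  with at least two rows and two columns.
\<close>

locale fixed_ends =
  fixes k :: int and X Y :: "int set" and x z :: int
  assumes k: "k > 0"
    and first: "\<And>w. slides k X w Y \<Longrightarrow> w \<noteq> [] \<and> hd w = x"
    and last: "\<And>w. slides k X w Y \<Longrightarrow> last w = z"
    and two: "\<exists>w w'. slides k X w Y \<and> slides k X w' Y \<and> w \<noteq> w'"
begin

abbreviation W :: "int list \<Rightarrow> bool" where "W w \<equiv> slides k X w Y"

text \<open>
  The level counts steps of size \<open>s\<close> away from \<open>x\<close>. With \<open>s = k\<close> and \<open>s = - k\<close>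
  the same statement covers both sides of \<open>x\<close>, which are exchanged by transposing the diagram.
\<close>

definition lv :: "int \<Rightarrow> int \<Rightarrow> int" where "lv s i = x + i * s"

definition side :: "int \<Rightarrow> bool" where "side s \<longleftrightarrow> s = k \<or> s = - k"

lemma side_k [simp]: "side k" "side (- k)" by (auto simp: side_def)

lemma side_uminus: "side s \<Longrightarrow> side (- s)" by (auto simp: side_def)

lemma lv_0 [simp]: "lv s 0 = x" by (simp add: lv_def)

lemma lv_uminus: "lv (- s) i = lv s (- i)" by (simp add: lv_def)

lemma lv_eq: "side s \<Longrightarrow> lv s i = lv s j \<longleftrightarrow> i = j"
  using k by (auto simp: lv_def side_def)

lemma lv_eq_x: "side s \<Longrightarrow> lv s i = x \<longleftrightarrow> i = 0"
  using lv_eq[of s i 0] by simp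

lemma adj_lv: "side s \<Longrightarrow> adj k (lv s i) c \<longleftrightarrow> c = lv s (i + 1) \<or> c = lv s (i - 1)"
  by (auto simp: adj_def lv_def side_def algebra_simps)

lemma adj_lv': "side s \<Longrightarrow> adj k c (lv s i) \<longleftrightarrow> c = lv s (i + 1) \<or> c = lv s (i - 1)"
  using adj_lv adj_commute by blast

lemma adj_lv_lv: "side s \<Longrightarrow> adj k (lv s i) (lv s j) \<longleftrightarrow> j = i + 1 \<or> j = i - 1"
  by (simp add: adj_lv lv_eq)

lemma adj_x: "side s \<Longrightarrow> adj k x c \<longleftrightarrow> c = lv s 1 \<or> c = lv s (- 1)"
  "side s \<Longrightarrow> adj k c x \<longleftrightarrow> c = lv s 1 \<or> c = lv s (- 1)"
  using adj_lv[of s 0 c] adj_lv'[of s c 0] by simp_all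

lemma between:
  assumes "W (p @ lv s i # us @ lv s i # vs)" "side s"
  shows "lv s (i + 1) \<in> set us" "lv s (i - 1) \<in> set us"
  using slides_between[OF k assms(1)] assms(2) by (auto simp: lv_def side_def algebra_simps)

text \<open>
  Otherwise \<open>c\<close> could be slid to the front, and a word would begin with \<open>c\<close>.
\<close>

lemma connected_letter:
  assumes "W (us @ c # vs)" "c \<noteq> x"
  shows "\<exists>u\<in>set us. adj k u c"
proof (rule ccontr)
  assume "\<not> ?thesis"
  then have "W ([] @ c # us @ vs)" using assms(1) by (intro slides_pull) auto
  then show False using first assms(2) by fastforce
qed

lemma letters_lv:
  assumes "W (us @ vs)" "c \<in> set us" "side s"
  shows "\<exists>i. c = lv s i"
  using assms(1,2)
proof (induction us arbitrary: c vs rule: rev_induct)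
  case (snoc a us)
  have IH: "\<exists>i. u = lv s i" if "u \<in> set us" for u
    using snoc.IH[of "a # vs" u] snoc.prems that by simp
  have "\<exists>i. a = lv s i"
  proof (cases "a = x")
    case True
    then show ?thesis by (metis lv_0)
  next
    case False
    then obtain u where "u \<in> set us" "adj k u a" using connected_letter[of us a vs] snoc.prems by auto
    then show ?thesis using IH adj_lv[OF assms(3)] by metis
  qed
  then show ?case using IH snoc.prems by auto
qed simp

text \<open>
  A new letter is adjacent to an earlier one by \<open>connected_letter\<close>. That neighbour is not further
  away from \<open>x\<close>, as otherwise the letter would not be new; so the levels are entered in order.
\<close>

lemma lower_levels:
  assumes "W (us @ vs)" "lv s i \<in> set us" "side s" "0 \<le> j" "j \<le> i"
  shows "lv s j \<in> set us"
  using assms(1,2,4,5)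
proof (induction us arbitrary: i j vs rule: rev_induct)
  case (snoc a us)
  have IH: "lv s j \<in> set us" if "lv s i \<in> set us" "0 \<le> j" "j \<le> i" for i j
    using snoc.IH[of "a # vs" i j] snoc.prems that by simp
  show ?case
  proof (cases "lv s i \<in> set us \<or> i = j")
    case True
    then show ?thesis using IH[of i j] snoc.prems by auto
  next
    case False
    then have a: "a = lv s i" "i > 0" using snoc.prems by auto
    then have "a \<noteq> x" using lv_eq_x[OF assms(3)] by auto
    then obtain u where u: "u \<in> set us" "adj k u a" using connected_letter[of us a vs] snoc.prems by auto
    then have "u = lv s (i + 1) \<or> u = lv s (i - 1)" using a adj_lv'[OF assms(3)] by simp
    moreover have "u \<noteq> lv s (i + 1)" using IH[of "i + 1" i] u a False by auto
    ultimately have "lv s (i - 1) \<in> set us" using u by auto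
    then show ?thesis using IH[of "i - 1" j] snoc.prems False by auto
  qed
qed simp

lemma set_word_eq: "W w \<Longrightarrow> W w' \<Longrightarrow> set w = set w'"
  using slides_mset[OF k] by (metis set_mset_mset)

text \<open>
  If one side of \<open>x\<close> is never entered, no letter can be repeated, because a repetition of level
  \<open>j\<close> requires a repetition of level \<open>j - 1\<close>. Then the word runs through the levels
  \<open>0, 1, 2, \<dots>\<close>, and there is only one such word.
\<close>

lemma both_neighbours_occur:
  assumes "W w" "side s"
  shows "lv s (- 1) \<in> set w"
proof (rule ccontr)
  assume no: "lv s (- 1) \<notin> set w"
  have chain: "w' ! i = lv s (int i)" if w': "W w'" and "i < length w'" for w' i
    using that(2)
  proof (induction i rule: less_induct)
    case (less i)
    have no': "lv s (- 1) \<notin> set w'" using no set_word_eq[OF assms(1) w'] by simp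
    have split: "w' = take i w' @ w' ! i # drop (Suc i) w'" using less.prems by (rule id_take_nth_drop)
    have hd: "w' ! 0 = x" using first[OF w'] hd_conv_nth[of w'] by auto
    have nth: "w' ! l = lv s (int l)" if "l < i" for l using less.IH that less.prems by simp
    have rep: False if j: "j < i" "w' ! i = lv s (int j)" for j
    proof -
      have "take i w' = take j w' @ w' ! j # drop (Suc j) (take i w')"
        using id_take_nth_drop[of j "take i w'"] j(1) less.prems by simp
      then have "W (take j w' @ lv s (int j) # drop (Suc j) (take i w') @ lv s (int j) # drop (Suc i) w')"
        using split w' j nth[OF j(1)] by (metis append_Cons append_assoc)
      from between(2)[OF this assms(2)]
      obtain m where m: "m < length (drop (Suc j) (take i w'))" "drop (Suc j) (take i w') ! m = lv s (int j - 1)"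
        by (metis in_set_conv_nth)
      then have "w' ! (Suc j + m) = lv s (int j - 1)" "Suc j + m < i" using less.prems by auto
      then show False using nth[of "Suc j + m"] lv_eq[OF assms(2)] by auto
    qed
    show ?case
    proof (cases "i = 0")
      case True
      then show ?thesis using hd by simp
    next
      case False
      have "w' ! i \<noteq> x" using rep[of 0] False by auto
      then obtain u where u: "u \<in> set (take i w')" "adj k u (w' ! i)"
        using connected_letter[of "take i w'" "w' ! i" "drop (Suc i) w'"] split w' by metis
      then obtain l where l: "l < i" "u = lv s (int l)"
        using nth less.prems by (auto simp: in_set_conv_nth)
      then have "w' ! i = lv s (int l + 1) \<or> w' ! i = lv s (int l - 1)"
        using u adj_lv[OF assms(2)] by auto
      then obtain j where j: "w' ! i = lv s j" "- 1 \<le> j" "j \<le> int i" using l by force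
      have "j \<noteq> - 1" using j(1) no' less.prems by (metis nth_mem)
      then have "j = int (nat j)" using j by simp
      then have "\<not> nat j < i" using rep[of "nat j"] j by metis
      then show ?thesis using j by (metis \<open>j = int (nat j)\<close> nat_le_iff le_less not_le of_nat_le_iff order_antisym)
    qed
  qed
  obtain w1 w2 where w: "W w1" "W w2" "w1 \<noteq> w2" using two by blast
  have "length w1 = length w2" using slides_mset[OF k w(1,2)] by (metis size_mset)
  then have "w1 = w2" using chain w by (intro nth_equalityI) auto
  then show False using w by simp
qed

lemma both_neighbours_occur':
  assumes "W w" "side s"
  shows "lv s 1 \<in> set w"
  using both_neighbours_occur[OF assms(1) side_uminus[OF assms(2)]] by (simp add: lv_uminus)

text \<open>
  If \<open>x\<close> occurred only at the beginning, letters on different sides of it would be independent, and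
  the last letter on either side could be slid to the end of the word.
\<close>

lemma first_letter_returns:
  assumes "W (x # r)"
  shows "x \<in> set r"
proof (rule ccontr)
  assume nx: "x \<notin> set r"
  have ne: "lv s (- 1) \<in> set r" if "side s" for s
    using both_neighbours_occur[OF assms that] lv_eq_x[OF that] by auto
  then have "r \<noteq> []" using side_k by fastforce
  then have z: "z \<in> set r" using last[OF assms] by auto
  have lvs: "\<exists>i. c = lv s i \<and> i \<noteq> 0" if "c \<in> set r" "side s" for c s
    using letters_lv[of "x # r" "[]" c s] assms that nx by (metis append_Nil2 list.set_intros(2) lv_0)
  obtain i where "z = lv k i" "i \<noteq> 0" using lvs[OF z side_k(1)] by blast
  then have "side k \<and> z = lv k i \<and> i > 0 \<or> side (- k) \<and> z = lv (- k) (- i) \<and> - i > 0"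
    by (auto simp: lv_uminus)
  then obtain s i where s: "side s" "z = lv s i" "i > 0" by blast
  let ?P = "\<lambda>c. \<exists>j<0. c = lv s j"
  have "?P (lv s (- 1))" by (intro exI[of _ "- 1"]) simp
  then obtain r1 c r2 where c: "r = r1 @ c # r2" "?P c" "\<forall>b\<in>set r2. \<not> ?P b"
    using split_list_last_prop[of r ?P] ne[OF s(1)] by blast
  then obtain j where j: "c = lv s j" "j < 0" by blast
  have "\<not> adj k u c" if "u \<in> set r2" for u
  proof -
    have "u \<in> set r" using that c(1) by simp
    then obtain m where "u = lv s m" "m \<noteq> 0" using lvs[of u s] s(1) by blast
    then have "m > 0" using c(3) that by (metis linorder_neqE_linordered_idom)
    then show ?thesis using \<open>u = lv s m\<close> j adj_lv_lv[OF s(1)] by auto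
  qed
  then have "W ((x # r1) @ r2 @ c # [])" using assms c(1) by (intro slides_push) auto
  then have "c = z" using last by fastforce
  then show False using j s lv_eq by auto
qed

text \<open>
  The rest \<open>r\<close> is a separate argument because the first block can be rearranged without any change
  to the rest.
\<close>

definition first_block :: "nat \<Rightarrow> int list \<Rightarrow> int list \<Rightarrow> int list \<Rightarrow> bool" where
  "first_block d v t r \<longleftrightarrow> W (t @ r) \<and> refines k d (t @ r) v \<and> length t = d \<and> distinct t"

lemma first_block_pull:
  assumes "first_block d v (p @ us @ c # q) r" "\<And>u. u \<in> set us \<Longrightarrow> \<not> adj k u c" "d > 0"
  shows "first_block d v (p @ c # us @ q) r"
proof -
  have "W (p @ c # us @ q @ r)" using assms by (intro slides_pull) (auto simp: first_block_def)
  moreover have "refines k d ([] @ (p @ c # us @ q) @ r) v"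
    by (rule refines_replace[of k d "[]" "p @ us @ c # q" r v "p @ c # us @ q" 0])
      (use assms in \<open>auto simp: first_block_def\<close>)
  ultimately show ?thesis using assms by (auto simp: first_block_def)
qed

text \<open>
  By \<open>lower_levels\<close> the letter at level \<open>i + 1\<close> comes after the one at level \<open>i\<close>, so the
  latter commutes with everything that it has to pass.
\<close>

lemma first_block_next_level:
  assumes c: "first_block d v (p @ q) r" and s: "side s" and i: "lv s i \<in> set q" "i \<ge> 1" "lv s (i - 1) \<in> set p"
  shows "\<exists>q'. first_block d v (p @ lv s i # q') r \<and> set (lv s i # q') = set q"
proof -
  obtain us q1 where q: "q = us @ lv s i # q1" using i(1) split_list by metis
  have d: "distinct (p @ q)" using c by (simp add: first_block_def)
  have "\<not> adj k u (lv s i)" if u: "u \<in> set us" for u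
  proof
    assume "adj k u (lv s i)"
    then have "u = lv s (i + 1) \<or> u = lv s (i - 1)" using adj_lv'[OF s] by simp
    moreover have "u \<noteq> lv s (i - 1)" using d u q i(3) by auto
    moreover have "u \<noteq> lv s (i + 1)"
    proof
      assume "u = lv s (i + 1)"
      moreover have "W ((p @ us) @ (lv s i # q1 @ r))" using c q by (simp add: first_block_def)
      ultimately have "lv s i \<in> set (p @ us)"
        using lower_levels[of "p @ us" _ s "i + 1" i] u s i by auto
      then show False using d q by auto
    qed
    ultimately show False by blast
  qed
  moreover have "d > 0" using c q by (auto simp: first_block_def)
  ultimately have "first_block d v (p @ lv s i # us @ q1) r" using c q by (intro first_block_pull) auto
  then show ?thesis using q by (intro exI[of _ "us @ q1"]) auto
qed

lemma first_block_hd: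
  assumes "first_block d v t r" "d > 0"
  obtains q where "t = x # q"
  using assms first[of "t @ r"] by (cases t) (auto simp: first_block_def)

text \<open>
  The letters next to \<open>x\<close> may be put right behind it, in either order.
\<close>

lemma first_block_arrange:
  assumes c: "first_block d v t r" and s: "side s" and "lv s 1 \<in> set t" "lv s (- 1) \<in> set t"
  shows "\<exists>q. first_block d v (x # lv s 1 # lv s (- 1) # q) r \<and> set (x # lv s 1 # lv s (- 1) # q) = set t"
proof -
  have "d > 0" using assms by (auto simp: first_block_def)
  then obtain q where t: "t = x # q" using first_block_hd[OF c] by blast
  have "lv s 1 \<in> set q" using assms(3) t lv_eq_x[OF s] by auto
  then obtain q1 where q1: "first_block d v ([x] @ lv s 1 # q1) r" "set (lv s 1 # q1) = set q"
    using first_block_next_level[of d v "[x]" q r s 1] c t s by auto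
  have "lv s (- 1) \<noteq> lv s 1" "lv s (- 1) \<noteq> x" using lv_eq[OF s, of "- 1"] lv_eq_x[OF s, of "- 1"] by simp_all
  moreover have "lv s (- 1) \<in> insert x (insert (lv s 1) (set q1))" using assms(4) t q1(2) by auto
  ultimately have "lv (- s) 1 \<in> set q1" by (simp add: lv_uminus)
  then obtain q2 where q2: "first_block d v ([x, lv s 1] @ lv (- s) 1 # q2) r" "set (lv (- s) 1 # q2) = set q1"
    using first_block_next_level[of d v "[x, lv s 1]" q1 r "- s" 1] q1(1) side_uminus[OF s] by auto
  then show ?thesis using q1 t by (intro exI[of _ q2]) (auto simp: lv_uminus)
qed

text \<open>
  Before \<open>x\<close> returns, neither of its neighbours can occur a second time.
\<close>

lemma first_block_second_x:
  assumes c: "first_block d v t r" and t: "lv k 1 \<in> set t" "lv k (- 1) \<in> set t"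
  obtains us vs where "r = us @ x # vs" "\<And>u. u \<in> set us \<Longrightarrow> u \<noteq> x \<and> \<not> adj k u x"
proof -
  have "d > 0" using assms by (auto simp: first_block_def)
  then obtain q where q: "t = x # q" using first_block_hd[OF c] by blast
  have dt: "distinct t" "W (t @ r)" using c by (auto simp: first_block_def)
  have "x \<in> set (q @ r)" using first_letter_returns[of "q @ r"] dt q by simp
  then have "x \<in> set r" using dt q by auto
  then obtain us vs where r: "r = us @ x # vs" "x \<notin> set us" using split_list_first by metis
  have "\<not> adj k u x" if u: "u \<in> set us" for u
  proof
    assume "adj k u x"
    then have ut: "u \<in> set t" "u \<noteq> x"
      using adj_x(2)[of k u] t lv_eq_x[OF side_k(1), of 1] lv_eq_x[OF side_k(1), of "- 1"] by auto
    then obtain i where i: "i = 1 \<or> i = - 1" "u = lv k i" using \<open>adj k u x\<close> adj_x(2)[of k u] by auto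
    have "u \<in> set q" using ut q by auto
    then obtain q1 q2 where q12: "q = q1 @ u # q2" using split_list by metis
    obtain u1 u2 where u12: "us = u1 @ u # u2" using u split_list by metis
    have "W ((x # q1) @ lv k i # (q2 @ u1) @ lv k i # (u2 @ x # vs))"
      using dt q q12 u12 r i by simp
    from between[OF this side_k(1)] have "x \<in> set (q2 @ u1)" using i by auto
    then show False using dt q q12 u12 r by auto
  qed
  then show thesis using that r by metis
qed

lemma first_block_levels:
  assumes c: "first_block d v t r" and s: "side s" and no: "lv s (- 2) \<notin> set t" and b: "b \<in> set t"
  shows "\<exists>i\<ge>- 1. b = lv s i"
proof -
  have w: "W (t @ r)" using c by (simp add: first_block_def)
  obtain i where i: "b = lv s i" using letters_lv[OF w b s] by blast
  have "i \<ge> - 1"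
  proof (rule ccontr)
    assume "\<not> ?thesis"
    then have "lv (- s) 2 \<in> set t"
      using lower_levels[OF w _ side_uminus[OF s], of "- i" 2] b i by (simp add: lv_uminus)
    then show False using no by (simp add: lv_uminus)
  qed
  then show ?thesis using i by blast
qed

lemma refines_two_adj:
  assumes "refines k 2 T v" "2 * i + 1 < length T"
  shows "adj k (T ! (2 * i)) (T ! (2 * i + 1))"
proof -
  have "i < length v" using assms by (auto simp: refines_def)
  then have "set (take 2 (drop (i * 2) T)) = blk k 2 (v ! i)" using assms by (simp add: refines_def)
  moreover have "take 2 (drop (i * 2) T) = [T ! (2 * i), T ! (2 * i + 1)]"
    using assms(2) by (intro nth_equalityI) (auto simp: less_2_cases_iff nth_Cons' mult.commute)
  moreover have "blk k 2 (v ! i) = {v ! i, v ! i + k}" by (auto simp: blk_def numeral_2_eq_2 lessThan_Suc)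
  ultimately have "{T ! (2 * i), T ! (2 * i + 1)} = {v ! i, v ! i + k}" by simp
  then show ?thesis using k by (auto simp: adj_def doubleton_eq_iff)
qed

section \<open>Codes when the first and the last letter are forced\<close>

text \<open>
  The first block enters only one side of \<open>x\<close>. The first letter \<open>y\<close> on the other side is the
  reflection of the second letter of \<open>U\<close> at \<open>x\<close>, and it is slid to index \<open>d\<close>.
\<close>

definition code_one_side :: "nat \<Rightarrow> int list \<Rightarrow> int list \<Rightarrow> bool" where
  "code_one_side d v U \<longleftrightarrow> (\<exists>t us y vs. U = t @ y # us @ vs \<and> length t = d \<and> y = 2 * x - U ! 1
     \<and> y \<notin> set t \<and> (\<forall>u\<in>set us. \<not> adj k u y) \<and> refines k d (t @ us @ y # vs) v)"

text \<open>
  The first block enters both sides of \<open>x\<close>, and the second \<open>x\<close> is slid to index \<open>d\<close>. For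
  \<open>d = 3\<close> one letter is left before it, so that it sits at index \<open>4\<close> as it does for
  \<open>d = 4\<close>; these two sizes are told apart by the letter at index \<open>3\<close>. The letter at index
  \<open>2\<close> is the reflection of the one at index \<open>1\<close>, as for the codes \<open>code_one_side\<close> of
  size \<open>2\<close>, hence these have to be excluded.
\<close>

definition code_two_sides :: "nat \<Rightarrow> int list \<Rightarrow> int list \<Rightarrow> bool" where
  "code_two_sides d v U \<longleftrightarrow> d \<ge> 3 \<and> U ! 2 = 2 * x - U ! 1 \<and> (\<forall>v'. \<not> code_one_side 2 v' U)
     \<and> (\<exists>t us vs n. U = x # t @ take n us @ x # drop n us @ vs \<and> Suc (length t) = d \<and> x \<notin> set t
          \<and> n = (if d = 3 then 1 else 0) \<and> n \<le> length us
          \<and> (\<forall>u\<in>set us. u \<noteq> x \<and> \<not> adj k u x) \<and> refines k d (x # t @ us @ x # vs) v)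
     \<and> (d = 3 \<longrightarrow> U ! 3 = 2 * U ! 1 - x) \<and> (d = 4 \<longrightarrow> U ! 3 = 3 * x - 2 * U ! 1)"

lemma code_one_side_unique:
  assumes d: "d \<ge> 2" "d' \<ge> 2" and c: "code_one_side d v U" "code_one_side d' v' U"
  shows "d = d' \<and> v = v'"
proof -
  obtain t us y vs where U: "U = t @ y # us @ vs" "length t = d" "y = 2 * x - U ! 1" "y \<notin> set t"
     "\<forall>u\<in>set us. \<not> adj k u y" "refines k d (t @ us @ y # vs) v"
    using c(1) unfolding code_one_side_def by blast
  obtain t' us' y' vs' where U': "U = t' @ y' # us' @ vs'" "length t' = d'" "y' = 2 * x - U ! 1" "y' \<notin> set t'"
     "\<forall>u\<in>set us'. \<not> adj k u y'" "refines k d' (t' @ us' @ y' # vs') v'"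
    using c(2) unfolding code_one_side_def by blast
  have yy: "y = y'" using U(3) U'(3) by simp
  have "t = t' \<and> us @ vs = us' @ vs'"
    using split_at_first_eq[of t y "us @ vs" t' "us' @ vs'"] U(1,4) U'(1,4) yy by metis
  then have eq: "t = t'" "us @ vs = us' @ vs'" by auto
  then have dd: "d = d'" using U(2) U'(2) by simp
  have "refines k d (t @ us' @ y # vs') v'" using U'(6) unfolding eq(1) yy dd .
  moreover have "\<not> adj k u y" if "u \<in> set us \<union> set us'" for u using that U(5) U'(5) yy by blast
  ultimately have "v = v'" using refines_moved_letter[OF k d(1) U(2) U(6) _ eq(2)] by blast
  then show ?thesis using dd by simp
qed

lemma code_two_sides_unique:
  assumes c: "code_two_sides d v U" "code_two_sides d' v' U"
  shows "d = d' \<and> v = v'"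
proof -
  obtain t us vs n where U: "U = x # t @ take n us @ x # drop n us @ vs" "Suc (length t) = d" "x \<notin> set t"
      "n = (if d = 3 then 1 else 0)" "n \<le> length us"
      "\<forall>u\<in>set us. u \<noteq> x \<and> \<not> adj k u x" "refines k d (x # t @ us @ x # vs) v" "d \<ge> 3"
    using c(1) unfolding code_two_sides_def by blast
  obtain t' us' vs' n' where U': "U = x # t' @ take n' us' @ x # drop n' us' @ vs'" "Suc (length t') = d'" "x \<notin> set t'"
      "n' = (if d' = 3 then 1 else 0)" "n' \<le> length us'"
      "\<forall>u\<in>set us'. u \<noteq> x \<and> \<not> adj k u x" "refines k d' (x # t' @ us' @ x # vs') v'" "d' \<ge> 3"
    using c(2) unfolding code_two_sides_def by blast
  have "x \<notin> set (t @ take n us)" "x \<notin> set (t' @ take n' us')"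
    using U(3,6) U'(3,6) in_set_takeD by fastforce+
  moreover have "(t @ take n us) @ x # drop n us @ vs = (t' @ take n' us') @ x # drop n' us' @ vs'"
    using U(1) U'(1) by simp
  ultimately have eq: "t @ take n us = t' @ take n' us'" "drop n us @ vs = drop n' us' @ vs'"
    using split_at_first_eq[of "t @ take n us" x "drop n us @ vs" "t' @ take n' us'" "drop n' us' @ vs'"]
    by blast+
  then have "length t + n = length t' + n'" using U(5) U'(5)
    by (metis length_append length_take min.absorb2)
  then have "d = d' \<or> d = 3 \<and> d' = 4 \<or> d = 4 \<and> d' = 3"
    using U(2,4,8) U'(2,4,8) by (auto split: if_splits)
  moreover have "U ! 1 \<noteq> x"
  proof -
    have "U ! 1 = t ! 0" "t ! 0 \<in> set t" using U(1,2,8) by (cases t; simp)+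
    then show ?thesis using U(3) by metis
  qed
  ultimately have dd: "d = d'"
    using c unfolding code_two_sides_def by (elim disjE) auto
  then have nn: "n = n'" using U(4) U'(4) by simp
  then have tt: "t = t'" "take n us = take n' us'" using eq(1) U(2) U'(2) dd by auto
  then have "us @ vs = us' @ vs'" using eq(2) nn by (metis append_assoc append_take_drop_id)
  moreover have "refines k d ((x # t) @ us' @ x # vs') v'" using U'(7) unfolding tt(1) dd by simp
  moreover have "refines k d ((x # t) @ us @ x # vs) v" using U(7) by simp
  moreover have "\<not> adj k u x" if "u \<in> set us \<union> set us'" for u using that U(6) U'(6) by blast
  moreover have "length (x # t) = d" "d \<ge> 2" using U(2,8) by simp_all
  ultimately have "v = v'" using refines_moved_letter[OF k] by blast
  then show ?thesis using dd by simp
qed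

lemma code_one_two_disjoint:
  assumes d: "d \<ge> 2" and c: "code_one_side d v U" "code_two_sides d' v' U"
  shows False
proof -
  have "d \<noteq> 2" using c unfolding code_two_sides_def by blast
  then have "d > 2" using d by simp
  obtain t us y vs where U: "U = t @ y # us @ vs" "length t = d" "y = 2 * x - U ! 1" "y \<notin> set t"
    using c(1) unfolding code_one_side_def by blast
  have "U ! 2 = y" using c(2) U(3) unfolding code_two_sides_def by simp
  then have "y \<in> set t" using U \<open>d > 2\<close> by (metis nth_append nth_mem)
  then show False using U(4) by blast
qed

lemma second_letter:
  assumes "W (x # c # r)"
  obtains s where "side s" "c = lv s 1"
proof -
  have "c \<noteq> x"
  proof
    assume "c = x"
    then have "W ([] @ lv k 0 # [] @ lv k 0 # r)" using assms by simp
    from between[OF this side_k(1)] show False by simp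
  qed
  then have "adj k x c" using connected_letter[of "[x]" c r] assms by auto
  then have "c = lv k 1 \<or> c = lv (- k) 1" using adj_x(1)[of k c] by (simp add: lv_uminus)
  then show thesis using that side_k by blast
qed

lemma code_one_side_exists:
  assumes c: "first_block d v (x # lv s 1 # q) r" and s: "side s" and no: "lv s (- 1) \<notin> set (x # lv s 1 # q)"
  shows "\<exists>U. W U \<and> code_one_side d v U"
proof -
  let ?t = "x # lv s 1 # q" and ?y = "lv s (- 1)"
  have w: "W (?t @ r)" "refines k d (?t @ r) v" "length ?t = d" using c by (auto simp: first_block_def)
  have "?y \<in> set r" using both_neighbours_occur[OF w(1) s] no by auto
  then obtain us vs where r: "r = us @ ?y # vs" "?y \<notin> set us" using split_list_first by metis
  have na: "\<not> adj k u ?y" if u: "u \<in> set us" for u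
  proof
    assume "adj k u ?y"
    then have "u = x \<or> u = lv s (- 2)" using adj_lv'[OF s, of u "- 1"] by simp
    then show False
    proof
      assume "u = x"
      then obtain u1 u2 where "us = u1 @ x # u2" using u split_list by metis
      then have "W ([] @ lv s 0 # (lv s 1 # q @ u1) @ lv s 0 # (u2 @ ?y # vs))" using w r by simp
      from between(2)[OF this s] show False using no r \<open>us = _\<close> by auto
    next
      assume "u = lv s (- 2)"
      then have "lv (- s) 2 \<in> set (?t @ us)" using u by (simp add: lv_uminus)
      moreover have "W ((?t @ us) @ ?y # vs)" using w(1) r by simp
      ultimately have "lv (- s) 1 \<in> set (?t @ us)"
        using lower_levels[of "?t @ us" _ "- s" 2 1] side_uminus[OF s] by simp
      then show False using no r(2) by (simp add: lv_uminus)
    qed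
  qed
  have "W (?t @ ?y # us @ vs)" using w(1) r na by (intro slides_pull) auto
  moreover have "?y = 2 * x - (?t @ ?y # us @ vs) ! 1" by (simp add: lv_def)
  moreover have "refines k d (?t @ us @ ?y # vs) v" using w(2) r(1) by simp
  ultimately have "W (?t @ ?y # us @ vs) \<and> code_one_side d v (?t @ ?y # us @ vs)"
    unfolding code_one_side_def using w(3) na no by blast
  then show ?thesis by blast
qed

text \<open>
  After \<open>y\<close> has been put back, the letters with indices \<open>2 * i\<close> and \<open>2 * i + 1\<close> are
  adjacent. The conclusions list the traces of this that are used to recognise words which are not of
  this kind; \<open>us\<close> consists of the letters that \<open>y\<close> has been slid across.
\<close>

lemma code_one_side_two_cases:
  assumes s: "side s" and c: "code_one_side 2 v (x # lv s 1 # lv s (- 1) # r)"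
  obtains us vs where "r = us @ vs" "\<And>u. u \<in> set us \<Longrightarrow> \<not> adj k u (lv s (- 1))" "even (length us)"
    "vs \<noteq> []" "adj k (lv s (- 1)) (hd vs)"
    "2 \<le> length us \<Longrightarrow> adj k (us ! 0) (us ! 1)"
    "us = [] \<Longrightarrow> refines k 2 (x # lv s 1 # lv s (- 1) # r) v"
proof -
  let ?U = "x # lv s 1 # lv s (- 1) # r"
  obtain t us y vs where U: "?U = t @ y # us @ vs" "length t = 2" "y = 2 * x - ?U ! 1"
     "\<forall>u\<in>set us. \<not> adj k u y" "refines k 2 (t @ us @ y # vs) v"
    using c unfolding code_one_side_def by blast
  obtain t1 t2 where "t = [t1, t2]" using U(2) by (auto simp: length_Suc_conv numeral_2_eq_2)
  then have t: "t = [x, lv s 1]" "y = lv s (- 1)" "r = us @ vs" using U(1) by auto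
  let ?T = "t @ us @ y # vs"
  have adj2: "adj k (?T ! (2 * i)) (?T ! (2 * i + 1))" if "2 * i + 1 < length ?T" for i
    using refines_two_adj U(5) that by blast
  have evT: "even (length ?T)" using U(5) by (simp add: refines_def)
  have ev: "even (length us)"
  proof (rule ccontr)
    assume "odd (length us)"
    then obtain m where m: "length us = 2 * m + 1" by (auto elim: oddE)
    have "adj k (?T ! (2 * Suc m)) (?T ! (2 * Suc m + 1))" by (rule adj2) (simp add: m t)
    then have "adj k (us ! (2 * m)) y" using m by (simp add: t nth_append)
    then show False using U(4) m by (metis less_add_one nth_mem)
  qed
  have "odd (length vs)" using evT ev t by simp
  then have vs: "vs \<noteq> []" by auto
  obtain m where m: "length us = 2 * m" using ev by (auto elim: evenE)
  have "adj k (?T ! (2 * Suc m)) (?T ! (2 * Suc m + 1))" using vs by (intro adj2) (cases vs; simp add: m t)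
  then have hd: "adj k y (hd vs)" using m vs by (simp add: t nth_append hd_conv_nth)
  have two: "adj k (us ! 0) (us ! 1)" if "2 \<le> length us"
    using adj2[of 1] that by (cases us; cases "tl us"; simp add: t)
  have none: "refines k 2 (x # lv s 1 # lv s (- 1) # r) v" if "us = []"
    using U(5) that t by simp
  show thesis using that[OF t(3) _ ev vs hd[unfolded t(2)] two none] U(4)[unfolded t(2)] by blast
qed

lemma code_two_sides_exists:
  assumes s: "side s" and c: "first_block d v (x # lv s 1 # lv s (- 1) # q) (us @ x # vs)" and d: "d > 3"
    and us: "\<And>u. u \<in> set us \<Longrightarrow> u \<noteq> x \<and> \<not> adj k u x"
    and four: "d = 4 \<Longrightarrow> q ! 0 = lv s (- 2)"
    and no: "\<And>v'. \<not> code_one_side 2 v' (x # lv s 1 # lv s (- 1) # q @ x # us @ vs)"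
  shows "\<exists>U. W U \<and> code_two_sides d v U"
proof -
  let ?t = "lv s 1 # lv s (- 1) # q"
  have c': "W (x # ?t @ us @ x # vs)" "refines k d (x # ?t @ us @ x # vs) v" "Suc (length ?t) = d" "x \<notin> set ?t"
    using c by (auto simp: first_block_def)
  have "W ((x # ?t) @ x # us @ vs)" by (rule slides_pull) (use c'(1) us in auto)
  moreover have "code_two_sides d v (x # ?t @ x # us @ vs)"
    unfolding code_two_sides_def
  proof (intro conjI)
    have "x # ?t @ x # us @ vs = x # ?t @ take 0 us @ x # drop 0 us @ vs" "0 \<le> length us"
        "0 = (if d = 3 then 1 else 0 :: nat)"
      using d by simp_all
    then show "\<exists>t us' vs' n. x # ?t @ x # us @ vs = x # t @ take n us' @ x # drop n us' @ vs' \<and> Suc (length t) = d \<and>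
       x \<notin> set t \<and> n = (if d = 3 then 1 else 0) \<and> n \<le> length us' \<and>
       (\<forall>u\<in>set us'. u \<noteq> x \<and> \<not> adj k u x) \<and> refines k d (x # t @ us' @ x # vs') v"
      using c'(2-4) us by blast
    show "(x # ?t @ x # us @ vs) ! 2 = 2 * x - (x # ?t @ x # us @ vs) ! 1"
      by (simp add: lv_def)
    show "\<forall>v'. \<not> code_one_side 2 v' (x # ?t @ x # us @ vs)" using no by simp
    show "d = 4 \<longrightarrow> (x # ?t @ x # us @ vs) ! 3 = 3 * x - 2 * (x # ?t @ x # us @ vs) ! 1"
    proof
      assume "d = 4"
      then have "q = [lv s (- 2)]" using c'(3) four by (cases q) auto
      then show "(x # ?t @ x # us @ vs) ! 3 = 3 * x - 2 * (x # ?t @ x # us @ vs) ! 1"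
        by (simp add: lv_def numeral_3_eq_3)
    qed
  qed (use d in simp_all)
  ultimately show ?thesis unfolding append_Cons by blast
qed

text \<open>
  A pair at index \<open>2\<close> would be \<open>x - s\<close> and \<open>x + 2 * s\<close>, and if the letter
  \<open>x - s\<close> has been moved, the next pair would be \<open>x + 2 * s\<close> and \<open>x - 2 * s\<close>.
\<close>

lemma code_two_sides_exists_both_long:
  assumes s: "side s" and d: "d > 4"
    and c: "first_block d v (x # lv s 1 # lv s (- 1) # lv s 2 # lv s (- 2) # q) (us @ x # vs)"
    and us: "\<And>u. u \<in> set us \<Longrightarrow> u \<noteq> x \<and> \<not> adj k u x"
  shows "\<exists>U. W U \<and> code_two_sides d v U"
proof (rule code_two_sides_exists[OF s c])
  fix v'
  show "\<not> code_one_side 2 v' (x # lv s 1 # lv s (- 1) # (lv s 2 # lv s (- 2) # q) @ x # us @ vs)"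
  proof
    assume "code_one_side 2 v' (x # lv s 1 # lv s (- 1) # (lv s 2 # lv s (- 2) # q) @ x # us @ vs)"
    then obtain a b where ab: "(lv s 2 # lv s (- 2) # q) @ x # us @ vs = a @ b" "even (length a)"
        "adj k (lv s (- 1)) (hd b)" "2 \<le> length a \<Longrightarrow> adj k (a ! 0) (a ! 1)"
      using code_one_side_two_cases[OF s] by metis
    show False
    proof (cases "a = []")
      case True
      then have "hd b = lv s 2" using ab(1) by auto
      then show False using ab(3) adj_lv_lv[OF s, of "- 1" 2] by simp
    next
      case False
      then obtain m where "length a = Suc (Suc m)" using ab(2) by (cases "length a"; cases "length a - 1") auto
      then obtain a1 a2 a' where "a = a1 # a2 # a'" by (auto simp: length_Suc_conv)
      then have "adj k (lv s 2) (lv s (- 2))" using ab(1,4) by auto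
      then show False using adj_lv_lv[OF s, of 2 "- 2"] by simp
    qed
  qed
qed (use d us in auto)

text \<open>
  All of \<open>q\<close> lies on the other side of \<open>x\<close> than \<open>x - s\<close>, so the partner of
  \<open>x - s\<close> can only be the second \<open>x\<close>. But an odd number of letters lies between the two,
  while \<open>x - s\<close> can only have been slid across an even number.
\<close>

lemma code_two_sides_exists_even:
  assumes s: "side s" and d: "d > 4" "even d"
    and c: "first_block d v (x # lv s 1 # lv s (- 1) # q) (us @ x # vs)"
    and q: "\<And>b. b \<in> set q \<Longrightarrow> \<exists>i\<ge>2. b = lv s i"
    and us: "\<And>u. u \<in> set us \<Longrightarrow> u \<noteq> x \<and> \<not> adj k u x"
  shows "\<exists>U. W U \<and> code_two_sides d v U"
proof (rule code_two_sides_exists[OF s c])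
  fix v'
  have len: "odd (length q)" using c d by (auto simp: first_block_def)
  have qn: "\<not> adj k (lv s (- 1)) b" if "b \<in> set q" for b
    using q[OF that] adj_lv_lv[OF s, of "- 1"] by auto
  show "\<not> code_one_side 2 v' (x # lv s 1 # lv s (- 1) # q @ x # us @ vs)"
  proof
    assume "code_one_side 2 v' (x # lv s 1 # lv s (- 1) # q @ x # us @ vs)"
    then obtain a b where ab: "q @ x # us @ vs = a @ b" "even (length a)" "b \<noteq> []"
        "adj k (lv s (- 1)) (hd b)" "\<And>u. u \<in> set a \<Longrightarrow> \<not> adj k u (lv s (- 1))"
      using code_one_side_two_cases[OF s] by metis
    have hd: "hd b = (q @ x # us @ vs) ! length a" unfolding ab(1) using ab(3) by (cases b) simp_all
    consider "length a < length q" | "length a > length q" using ab(2) len by (metis linorder_neqE_nat)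
    then show False
    proof cases
      case 1
      then have "hd b \<in> set q" using hd by (simp add: nth_append)
      then show False using qn ab(4) by blast
    next
      case 2
      then have "a ! length q = x" "a ! length q \<in> set a"
        using arg_cong[OF ab(1), of "\<lambda>l. l ! length q"] by (simp_all add: nth_append)
      then show False using ab(5)[of x] adj_x(1)[OF s, of "lv s (- 1)"] by simp
    qed
  qed
qed (use d us in auto)

text \<open>
  Since \<open>x - 2 * s\<close> follows \<open>x - s\<close>, the latter has not been moved. Then the second
  \<open>x\<close>, which has an odd index, is paired with its predecessor, a letter that is not adjacent to it.
\<close>

lemma code_two_sides_exists_odd:
  assumes s: "side s" and d: "d > 4" "odd d"
    and c: "first_block d v (x # lv s 1 # lv s (- 1) # lv s (- 2) # q) (us @ x # vs)"
    and q: "\<And>b. b \<in> set q \<Longrightarrow> \<not> adj k b x"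
    and us: "\<And>u. u \<in> set us \<Longrightarrow> u \<noteq> x \<and> \<not> adj k u x"
  shows "\<exists>U. W U \<and> code_two_sides d v U"
proof (rule code_two_sides_exists[OF s c])
  fix v'
  have len: "d = length q + 4" using c by (auto simp: first_block_def)
  then have qne: "q \<noteq> []" "odd (length q)" using d by auto
  let ?r = "(lv s (- 2) # q) @ x # us @ vs"
  show "\<not> code_one_side 2 v' (x # lv s 1 # lv s (- 1) # ?r)"
  proof
    assume "code_one_side 2 v' (x # lv s 1 # lv s (- 1) # ?r)"
    then obtain a b where ab: "?r = a @ b" "\<And>u. u \<in> set a \<Longrightarrow> \<not> adj k u (lv s (- 1))"
        "a = [] \<Longrightarrow> refines k 2 (x # lv s 1 # lv s (- 1) # ?r) v'"
      using code_one_side_two_cases[OF s] by metis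
    have "a = []"
    proof (rule ccontr)
      assume "a \<noteq> []"
      then have "lv s (- 2) \<in> set a" using ab(1) by (cases a) auto
      then show False using ab(2) adj_lv_lv[OF s, of "- 2" "- 1"] by auto
    qed
    then have r: "refines k 2 (x # lv s 1 # lv s (- 1) # ?r) v'" using ab(3) by blast
    obtain m where m: "length q = 2 * m + 1" using qne(2) oddE by blast
    define A where "A = [x, lv s 1, lv s (- 1), lv s (- 2)]"
    define L where "L = A @ q @ x # us @ vs"
    have r': "refines k 2 L v'" using r by (simp add: L_def A_def)
    have lenA: "length A = 4" by (simp add: A_def)
    have "adj k (L ! (2 * (m + 2))) (L ! (2 * (m + 2) + 1))"
      by (rule refines_two_adj[OF r']) (simp add: L_def lenA m)
    moreover have "2 * (m + 2) = length A + 2 * m" "2 * (m + 2) + 1 = length A + length q"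
      using m lenA by simp_all
    ultimately have "adj k ((q @ x # us @ vs) ! (2 * m)) ((q @ x # us @ vs) ! length q)"
      unfolding L_def by (simp only: nth_append_length_plus)
    then have "adj k (q ! (2 * m)) x" using m by (simp only: nth_append_length) (simp add: nth_append)
    moreover have "q ! (2 * m) \<in> set q" using m by simp
    ultimately show False using q by blast
  qed
qed (use d us in auto)

text \<open>
  As in the odd case \<open>x - s\<close> has not been moved. The second \<open>x\<close> begins a pair here, and by
  assumption its successor is not adjacent to it.
\<close>

lemma code_two_sides_exists_four:
  assumes s: "side s"
    and c: "first_block 4 v [x, lv s 1, lv s (- 1), lv s (- 2)] (us @ x # vs)"
    and us: "\<And>u. u \<in> set us \<Longrightarrow> u \<noteq> x \<and> \<not> adj k u x"
    and g: "us @ vs \<noteq> []" "\<not> adj k x (hd (us @ vs))"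
  shows "\<exists>U. W U \<and> code_two_sides 4 v U"
proof (rule code_two_sides_exists[OF s c])
  fix v'
  let ?r = "[lv s (- 2)] @ x # us @ vs"
  show "\<not> code_one_side 2 v' (x # lv s 1 # lv s (- 1) # ?r)"
  proof
    assume "code_one_side 2 v' (x # lv s 1 # lv s (- 1) # ?r)"
    then obtain a b where ab: "?r = a @ b" "\<And>u. u \<in> set a \<Longrightarrow> \<not> adj k u (lv s (- 1))"
        "a = [] \<Longrightarrow> refines k 2 (x # lv s 1 # lv s (- 1) # ?r) v'"
      using code_one_side_two_cases[OF s] by metis
    have "a = []"
    proof (rule ccontr)
      assume "a \<noteq> []"
      then have "lv s (- 2) \<in> set a" using ab(1) by (cases a) auto
      then show False using ab(2) adj_lv_lv[OF s, of "- 2" "- 1"] by auto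
    qed
    then have r: "refines k 2 (x # lv s 1 # lv s (- 1) # ?r) v'" using ab(3) by blast
    obtain h l where h: "us @ vs = h # l" using g(1) by (cases "us @ vs") auto
    have "adj k ((x # lv s 1 # lv s (- 1) # ?r) ! (2 * 2)) ((x # lv s 1 # lv s (- 1) # ?r) ! (2 * 2 + 1))"
      by (rule refines_two_adj[OF r]) (simp add: h)
    then have "adj k x h" by (simp add: h)
    then show False using g(2) h by simp
  qed
qed (use us in auto)

text \<open>
  The letter \<open>x + 2 * s\<close> is neither adjacent to \<open>x - s\<close> nor to the second \<open>x\<close>.
\<close>

lemma code_two_sides_exists_three:
  assumes s: "side s"
    and c: "first_block 3 v [x, lv s 1, lv s (- 1)] (lv s 2 # us @ x # vs)"
    and us: "\<And>u. u \<in> set us \<Longrightarrow> u \<noteq> x \<and> \<not> adj k u x"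
  shows "\<exists>U. W U \<and> code_two_sides 3 v U"
proof -
  let ?t = "[lv s 1, lv s (- 1)]" and ?us = "lv s 2 # us"
  let ?U = "x # ?t @ [lv s 2] @ x # us @ vs"
  have n2: "lv s 2 \<noteq> x" "\<not> adj k (lv s 2) x"
    using lv_eq_x[OF s, of 2] adj_lv_lv[OF s, of 2 0] by simp_all
  have us': "\<forall>u\<in>set ?us. u \<noteq> x \<and> \<not> adj k u x" using us n2 by auto
  have c': "W (x # ?t @ ?us @ x # vs)" "refines k 3 (x # ?t @ ?us @ x # vs) v" "x \<notin> set ?t"
    using c by (auto simp: first_block_def)
  \<comment> \<open>The second \<open>x\<close> is slid to index \<open>4\<close>, leaving \<open>lv s 2\<close> at index \<open>3\<close>.\<close>
  have "W ((x # ?t @ [lv s 2]) @ x # us @ vs)" by (rule slides_pull) (use c'(1) us in auto)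
  then have "W ?U" by simp
  moreover have "\<not> code_one_side 2 v' ?U" for v'
  proof
    assume "code_one_side 2 v' ?U"
    then have "code_one_side 2 v' (x # lv s 1 # lv s (- 1) # lv s 2 # x # us @ vs)" by simp
    then obtain a b where ab: "lv s 2 # x # us @ vs = a @ b" "even (length a)"
        "adj k (lv s (- 1)) (hd b)" "2 \<le> length a \<Longrightarrow> adj k (a ! 0) (a ! 1)"
      using code_one_side_two_cases[OF s] by metis
    show False
    proof (cases "a = []")
      case True
      then have "hd b = lv s 2" using ab(1) by auto
      then show False using ab(3) adj_lv_lv[OF s, of "- 1" 2] by simp
    next
      case False
      then obtain m where "length a = Suc (Suc m)" using ab(2) by (cases "length a"; cases "length a - 1") auto
      then obtain a1 a2 a' where "a = a1 # a2 # a'" by (auto simp: length_Suc_conv)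
      then have "adj k (lv s 2) x" using ab(1,4) by auto
      then show False using n2 by simp
    qed
  qed
  moreover have "?U = x # ?t @ take 1 ?us @ x # drop 1 ?us @ vs" "1 \<le> length ?us" "Suc (length ?t) = 3"
      "1 = (if 3 = (3::nat) then 1 else 0 :: nat)"
    by simp_all
  then have "\<exists>t us' vs' n. ?U = x # t @ take n us' @ x # drop n us' @ vs' \<and> Suc (length t) = 3 \<and>
       x \<notin> set t \<and> n = (if 3 = (3::nat) then 1 else 0) \<and> n \<le> length us' \<and>
       (\<forall>u\<in>set us'. u \<noteq> x \<and> \<not> adj k u x) \<and> refines k 3 (x # t @ us' @ x # vs') v"
    using c'(2,3) us' by blast
  moreover have "?U ! 2 = 2 * x - ?U ! 1" "?U ! 3 = 2 * ?U ! 1 - x" by (simp_all add: lv_def numeral_3_eq_3)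
  ultimately have "code_two_sides 3 v ?U" unfolding code_two_sides_def by simp
  then show ?thesis using \<open>W ?U\<close> by blast
qed

lemma neighbour_sides:
  assumes "adj k x c"
  obtains s where "side s" "c = lv s 1"
  using assms adj_x(1)[of k c] side_k lv_uminus[of k 1] by metis

lemma set_both_sides:
  assumes "side s" "lv s 1 \<in> A" "lv s (- 1) \<in> A" "side s'"
  shows "lv s' 1 \<in> A" "lv s' (- 1) \<in> A"
  using assms by (auto simp: side_def lv_uminus)

text \<open>
  The next letter after the first block that is not \<open>x\<close> is at level \<open>2\<close> on one side. If
  \<open>x\<close> comes before it, the two can be exchanged within the second block. This decides on which side
  the second letter of the code is taken.
\<close>

lemma code_exists_three:
  assumes c: "first_block 3 v t r" and t: "lv k 1 \<in> set t" "lv k (- 1) \<in> set t"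
  shows "\<exists>U. W U \<and> code_two_sides 3 v U"
proof -
  obtain us vs where r: "r = us @ x # vs" and us: "\<And>u. u \<in> set us \<Longrightarrow> u \<noteq> x \<and> \<not> adj k u x"
    using first_block_second_x[OF c t] by metis
  have w: "W (t @ us @ x # vs)" "refines k 3 (t @ us @ x # vs) v" "length t = 3" "distinct t"
    using c r by (simp_all add: first_block_def)
  have sub: "{x, lv k 1, lv k (- 1)} \<subseteq> set t"
    using t first_block_hd[OF c] by (metis bot.extremum insert_subset list.set_intros(1) zero_less_numeral)
  have "card {x, lv k 1, lv k (- 1)} = 3"
    using lv_eq_x[OF side_k(1), of 1] lv_eq_x[OF side_k(1), of "- 1"] lv_eq[OF side_k(1), of 1 "- 1"] by auto
  then have st: "set t = {x, lv k 1, lv k (- 1)}"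
    using card_subset_eq[OF _ sub] w by (simp add: distinct_card)
  have next_level: "\<exists>s. side s \<and> g = lv s 2"
    if "W (t @ p @ g # l)" "set p \<subseteq> {x}" "g \<noteq> x" "\<not> adj k x g" for p g l
  proof -
    have "\<exists>u\<in>set (t @ p). adj k u g" using connected_letter[of "t @ p" g l] that(1,3) by simp
    then obtain u where u: "u \<in> set (t @ p)" "adj k u g" by blast
    then have "u = lv k 1 \<or> u = lv (- k) 1" using st that by (auto simp: lv_uminus)
    then obtain s where s: "side s" "u = lv s 1" using side_k by blast
    then have "g = lv s 2" using u(2) adj_lv[OF s(1), of 1 g] that(3) by auto
    then show ?thesis using s by blast
  qed
  have "\<exists>s us' vs'. side s \<and> first_block 3 v t (lv s 2 # us' @ x # vs') \<and> (\<forall>u\<in>set us'. u \<noteq> x \<and> \<not> adj k u x)"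
  proof (cases us)
    case (Cons g us')
    obtain s where "side s" "g = lv s 2"
      using next_level[of "[]" g "us' @ x # vs"] w(1) us[of g] Cons adj_commute by auto
    then show ?thesis using c r us Cons
      by (intro exI[of _ s] exI[of _ us'] exI[of _ vs]) auto
  next
    case Nil
    have "3 * length v = 4 + length vs" using w(2,3) Nil by (simp add: refines_def)
    then have "length vs \<ge> 2" by presburger
    then obtain g e vs' where vs: "vs = g # e # vs'" by (cases vs; cases "tl vs") auto
    have w': "W (t @ [x] @ g # e # vs')" using w(1) Nil vs by simp
    have gx: "g \<noteq> x"
    proof
      assume "g = x"
      then have "W (t @ lv k 0 # [] @ lv k 0 # e # vs')" using w' by simp
      from between[OF this side_k(1)] show False by simp
    qed
    have na: "\<not> adj k x g"
    proof
      assume "adj k x g"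
      then obtain s where s: "side s" "g = lv s 1" using neighbour_sides by blast
      then have "g \<in> set t" using set_both_sides[OF side_k(1) t s(1)] by simp
      then obtain t1 t2 where t12: "t = t1 @ g # t2" using split_list by metis
      have "W (t1 @ lv s 1 # (t2 @ [x]) @ lv s 1 # e # vs')" using w' t12 s by simp
      from between(1)[OF this s(1)] have "lv s 2 \<in> set t" using t12 sub by auto
      then have "lv s 2 = lv s 0 \<or> lv s 2 = lv s 1 \<or> lv s 2 = lv s (- 1)"
        using st s(1) by (auto simp: side_def lv_uminus)
      then show False using lv_eq[OF s(1), of 2 0] lv_eq[OF s(1), of 2 1] lv_eq[OF s(1), of 2 "- 1"] by simp
    qed
    obtain s where s: "side s" "g = lv s 2"
      using next_level[OF w' _ gx na] by auto
    have "W (t @ g # [x] @ e # vs')" by (rule slides_pull) (use w' na in auto)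
    moreover have "refines k 3 (t @ [g, x, e] @ vs') v"
      by (rule refines_replace[of k 3 t "[x, g, e]" vs' v "[g, x, e]" 1]) (use w Nil vs in auto)
    ultimately have "first_block 3 v t (lv s 2 # [] @ x # e # vs')" using w s by (simp add: first_block_def)
    then show ?thesis using s by (intro exI[of _ s] exI[of _ "[]"] exI[of _ "e # vs'"]) auto
  qed
  then obtain s us' vs' where s: "side s" "first_block 3 v t (lv s 2 # us' @ x # vs')"
      "\<And>u. u \<in> set us' \<Longrightarrow> u \<noteq> x \<and> \<not> adj k u x" by blast
  obtain q where "first_block 3 v (x # lv s 1 # lv s (- 1) # q) (lv s 2 # us' @ x # vs')"
    using first_block_arrange[OF s(2,1)] set_both_sides[OF side_k(1) t s(1)] by blast
  moreover from this have "q = []" by (simp add: first_block_def)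
  ultimately show ?thesis using code_two_sides_exists_three[OF s(1) _ s(3)] by blast
qed

text \<open>
  If the second \<open>x\<close> comes right behind the first block and is followed by one of its neighbours,
  this is \<open>x - s\<close>, and the letter after it commutes with it and is not adjacent to \<open>x\<close>. These two letters belong to the second block and can
  be exchanged.
\<close>

lemma code_exists_four:
  assumes s: "side s" and c: "first_block 4 v [x, lv s 1, lv s (- 1), lv s (- 2)] (us @ x # vs)"
    and us: "\<And>u. u \<in> set us \<Longrightarrow> u \<noteq> x \<and> \<not> adj k u x"
  shows "\<exists>U. W U \<and> code_two_sides 4 v U"
proof (cases us)
  case (Cons g us')
  then have "us @ vs \<noteq> []" "\<not> adj k x (hd (us @ vs))" using us[of g] adj_commute by auto
  then show ?thesis using code_two_sides_exists_four[OF s c us] by blast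
next
  case Nil
  let ?t = "[x, lv s 1, lv s (- 1), lv s (- 2)]"
  have w: "W (?t @ x # vs)" "refines k 4 (?t @ x # vs) v" "distinct ?t"
    using c Nil by (simp_all add: first_block_def)
  have "4 * length v = 5 + length vs" using w(2) by (simp add: refines_def)
  then have "length vs \<ge> 3" by presburger
  then obtain b e f vs' where vs: "vs = b # e # f # vs'"
    by (cases vs; cases "tl vs"; cases "tl (tl vs)") auto
  show ?thesis
  proof (cases "adj k x b")
    case False
    then show ?thesis using code_two_sides_exists_four[OF s c us] vs Nil by auto
  next
    case True
    have "b \<noteq> lv s 1"
    proof
      assume "b = lv s 1"
      then have "W ([x] @ lv s 1 # [lv s (- 1), lv s (- 2), x] @ lv s 1 # e # f # vs')" using w(1) vs by simp
      from between(1)[OF this s] show False using lv_eq[OF s] lv_eq_x[OF s] by auto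
    qed
    then have b: "b = lv s (- 1)" using True adj_x(1)[OF s] by blast
    have w': "W (?t @ x # lv s (- 1) # e # f # vs')" using w(1) vs b by simp
    \<comment> \<open>Each of the four values would be a repetition without one of the neighbours that has to occur in
      between.\<close>
    have e1: "e \<noteq> lv s 1"
    proof
      assume "e = lv s 1"
      then have "W ([x] @ lv s 1 # [lv s (- 1), lv s (- 2), x, lv s (- 1)] @ lv s 1 # f # vs')" using w' by simp
      from between(1)[OF this s] show False using lv_eq[OF s] lv_eq_x[OF s] by auto
    qed
    have e2: "e \<noteq> lv s (- 1)"
    proof
      assume "e = lv s (- 1)"
      then have "W ((?t @ [x]) @ lv s (- 1) # [] @ lv s (- 1) # f # vs')" using w' by simp
      from between(1)[OF this s] show False by simp
    qed
    have e3: "e \<noteq> x"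
    proof
      assume "e = x"
      then have "W (?t @ lv s 0 # [lv s (- 1)] @ lv s 0 # f # vs')" using w' by simp
      from between(1)[OF this s] show False using lv_eq[OF s] by auto
    qed
    have e4: "e \<noteq> lv s (- 2)"
    proof
      assume "e = lv s (- 2)"
      then have "W ([x, lv s 1, lv s (- 1)] @ lv s (- 2) # [x, lv s (- 1)] @ lv s (- 2) # f # vs')" using w' by simp
      from between(2)[OF this s] show False using lv_eq[OF s] lv_eq_x[OF s] by auto
    qed
    have na: "\<not> adj k (lv s (- 1)) e" using e3 e4 adj_lv[OF s, of "- 1" e] by simp
    have "W ((?t @ [x]) @ e # [lv s (- 1)] @ f # vs')" by (rule slides_pull) (use w' na in auto)
    moreover have "refines k 4 (?t @ [x, e, lv s (- 1), f] @ vs') v"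
      by (rule refines_replace[of k 4 ?t "[x, lv s (- 1), e, f]" vs' v "[x, e, lv s (- 1), f]" 1])
        (use w vs b in auto)
    ultimately have "first_block 4 v ?t ([] @ x # e # lv s (- 1) # f # vs')" using w(3) by (simp add: first_block_def)
    moreover have "\<not> adj k x e" using e1 e2 adj_x(1)[OF s] by blast
    ultimately show ?thesis
      using code_two_sides_exists_four[OF s, of v "[]" "e # lv s (- 1) # f # vs'"] by simp
  qed
qed

text \<open>
  The first block reaches level \<open>2\<close> on at least one side. The arrangement depends on whether it does
  so on both sides, and otherwise on the parity of \<open>d\<close>: for even \<open>d > 4\<close> the code
  begins on the longer side, for odd \<open>d\<close> and \<open>d = 4\<close> on the shorter side.
\<close>

lemma code_exists_long:
  assumes d: "d > 3" and c: "first_block d v t r" and t: "lv k 1 \<in> set t" "lv k (- 1) \<in> set t"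
  shows "\<exists>U. W U \<and> code_two_sides d v U"
proof -
  obtain us vs where r: "r = us @ x # vs" and us: "\<And>u. u \<in> set us \<Longrightarrow> u \<noteq> x \<and> \<not> adj k u x"
    using first_block_second_x[OF c t] by metis
  have w: "W (t @ r)" "card (set t) = d"
    using c by (simp_all add: first_block_def distinct_card)
  have "\<not> set t \<subseteq> {x, lv k 1, lv k (- 1)}"
  proof
    assume "set t \<subseteq> {x, lv k 1, lv k (- 1)}"
    then have "card (set t) \<le> card {x, lv k 1, lv k (- 1)}" by (intro card_mono) auto
    also have "\<dots> \<le> 3" by (simp add: card_insert_if)
    finally show False using w d by simp
  qed
  then obtain b where b: "b \<in> set t" "b \<noteq> x" "b \<noteq> lv k 1" "b \<noteq> lv k (- 1)" by blast
  obtain i where i: "b = lv k i" using letters_lv[OF w(1) b(1) side_k(1)] by blast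
  have "i \<noteq> 0" "i \<noteq> 1" "i \<noteq> - 1" using b i by auto
  then consider "i \<ge> 2" | "- i \<ge> 2" by linarith
  then have "\<exists>s. side s \<and> lv s 2 \<in> set t"
  proof cases
    case 1
    then have "lv k 2 \<in> set t" using lower_levels[OF w(1), of k i 2] b i by auto
    then show ?thesis using side_k by blast
  next
    case 2
    then have "lv (- k) 2 \<in> set t" using lower_levels[OF w(1), of "- k" "- i" 2] b i by (simp add: lv_uminus)
    then show ?thesis using side_k by blast
  qed
  then obtain s where s: "side s" "lv s 2 \<in> set t" by blast
  have t1: "lv s 1 \<in> set t" "lv s (- 1) \<in> set t" using set_both_sides[OF side_k(1) t s(1)] .
  have sm: "side (- s)" using s side_uminus by blast
  note eqs = lv_eq[OF s(1)] lv_eq_x[OF s(1)]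
  show ?thesis
  proof (cases "lv s (- 2) \<in> set t")
    case True
    obtain q where q: "first_block d v ([x, lv s 1, lv s (- 1)] @ q) r" "set (x # lv s 1 # lv s (- 1) # q) = set t"
      using first_block_arrange[OF c s(1) t1] by auto
    have "lv s 2 \<in> set (x # lv s 1 # lv s (- 1) # q)" "lv s (- 2) \<in> set (x # lv s 1 # lv s (- 1) # q)"
      using q(2) s(2) True by simp_all
    then have q2: "lv s 2 \<in> set q" "lv s (- 2) \<in> set q" by (simp_all add: eqs)
    obtain q1 where q1: "first_block d v ([x, lv s 1, lv s (- 1)] @ lv s 2 # q1) r" "set (lv s 2 # q1) = set q"
      using first_block_next_level[OF q(1) s(1) q2(1)] by auto
    have "lv s (- 2) \<in> set (lv s 2 # q1)" using q1(2) q2(2) by simp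
    then have "lv (- s) 2 \<in> set q1" by (simp add: eqs lv_uminus)
    then obtain q' where "first_block d v ([x, lv s 1, lv s (- 1), lv s 2] @ lv (- s) 2 # q') r"
      using first_block_next_level[of d v "[x, lv s 1, lv s (- 1), lv s 2]" q1 r "- s" 2] q1(1) sm
      by (auto simp: lv_uminus)
    then have c': "first_block d v (x # lv s 1 # lv s (- 1) # lv s 2 # lv s (- 2) # q') (us @ x # vs)"
      using r by (simp add: lv_uminus)
    then have "length (x # lv s 1 # lv s (- 1) # lv s 2 # lv s (- 2) # q') = d" unfolding first_block_def by blast
    then have "d > 4" by simp
    then show ?thesis using code_two_sides_exists_both_long[OF s(1) _ c' us] by blast
  next
    case False
    have lev: "\<exists>i\<ge>- 1. b = lv s i" if "b \<in> set t" for b using first_block_levels[OF c s(1) False that] .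
    show ?thesis
    proof (cases "even d \<and> d > 4")
      case True
      obtain q where q: "first_block d v (x # lv s 1 # lv s (- 1) # q) r" "set (x # lv s 1 # lv s (- 1) # q) = set t"
        using first_block_arrange[OF c s(1) t1] by auto
      have "\<exists>i\<ge>2. b = lv s i" if b: "b \<in> set q" for b
      proof -
        have "b \<in> set (x # lv s 1 # lv s (- 1) # q)" using b by simp
        then obtain i where i: "i \<ge> - 1" "b = lv s i" using lev q(2) by metis
        have "b \<noteq> x" "b \<noteq> lv s 1" "b \<noteq> lv s (- 1)" using q(1) b by (auto simp: first_block_def)
        then have "i \<noteq> 0" "i \<noteq> 1" "i \<noteq> - 1" using i by auto
        then show ?thesis using i by (intro exI[of _ i]) auto
      qed
      then show ?thesis using code_two_sides_exists_even[OF s(1) _ _ q(1)[unfolded r] _ us] True by blast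
    next
      case False
      obtain q where q: "first_block d v (x # lv (- s) 1 # lv (- s) (- 1) # q) r" "set (x # lv (- s) 1 # lv (- s) (- 1) # q) = set t"
        using first_block_arrange[OF c sm] t1 by (auto simp: lv_uminus)
      have "lv s 2 \<in> set (x # lv (- s) 1 # lv (- s) (- 1) # q)" using q(2) s(2) by simp
      then have "lv s 2 \<in> set q" by (simp add: eqs lv_uminus)
      then obtain q' where q': "first_block d v ([x, lv (- s) 1, lv (- s) (- 1)] @ lv s 2 # q') r" "set (lv s 2 # q') = set q"
        using first_block_next_level[of d v "[x, lv (- s) 1, lv (- s) (- 1)]" q r s 2] q(1) s(1) by (auto simp: lv_uminus)
      have c': "first_block d v (x # lv (- s) 1 # lv (- s) (- 1) # lv (- s) (- 2) # q') (us @ x # vs)"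
        using q'(1) r by (simp add: lv_uminus)
      show ?thesis
      proof (cases "d = 4")
        case True
        then have "q' = []" using c' by (simp add: first_block_def)
        then show ?thesis using code_exists_four[OF sm _ us] c' True by blast
      next
        case d4: False
        have "\<not> adj k b x" if b: "b \<in> set q'" for b
        proof
          assume "adj k b x"
          then have "b = lv s 1 \<or> b = lv s (- 1)" using adj_x(2)[OF s(1)] by blast
          then show False using c' b by (auto simp: first_block_def lv_uminus)
        qed
        moreover have "d > 4" "odd d" using d d4 False by auto
        ultimately show ?thesis using code_two_sides_exists_odd[OF sm _ _ c' _ us] by blast
      qed
    qed
  qed
qed

lemma code_exists:
  assumes d: "d \<ge> 2" and v: "slides (int d * k) X v Y"
  shows "\<exists>U. W U \<and> (code_one_side d v U \<or> code_two_sides d v U)"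
proof -
  have d0: "d > 0" using d by simp
  obtain T where T: "W T" "refines k d T v" using slides_refine[OF k d0 v] by blast
  obtain t r where t: "T = t @ r" "length t = d" "distinct t"
    using split_first_block[OF T d0 k] first[OF T(1)] by metis
  have c: "first_block d v t r" using T t by (simp add: first_block_def)
  obtain q0 where q0: "t = x # q0" using first_block_hd[OF c d0] by blast
  then obtain a q where tq: "t = x # a # q" using t(2) d by (cases q0) auto
  have "W (x # a # q @ r)" using T t tq by simp
  then obtain s where s: "side s" "a = lv s 1" using second_letter by blast
  show ?thesis
  proof (cases "lv s (- 1) \<in> set t")
    case False
    then show ?thesis using code_one_side_exists[of d v s q r] c s tq by auto
  next
    case True
    have tk: "lv k 1 \<in> set t" "lv k (- 1) \<in> set t"
      using set_both_sides[OF s(1) _ True side_k(1)] tq s by simp_all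
    have "lv s (- 1) \<in> set q" using True tq s lv_eq[OF s(1), of "- 1" 1] lv_eq_x[OF s(1), of "- 1"] by auto
    then have "d \<ge> 3" using t(2) tq by (cases q) auto
    then show ?thesis using code_exists_three[of v t r] code_exists_long[of d v t r] c tk
      by (cases "d = 3") auto
  qed
qed

lemma sum_le_fixed_ends:
  assumes fin: "finite {w. W w}" and D: "\<And>d. d \<in> D \<Longrightarrow> d \<ge> 2"
  shows "(\<Sum>d\<in>D. card {v. slides (int d * k) X v Y}) \<le> card {w. W w}"
proof (rule sum_card_le_by_codes[where code = "\<lambda>d v U. code_one_side d v U \<or> code_two_sides d v U", OF fin])
  show "\<exists>U\<in>{w. W w}. code_one_side d v U \<or> code_two_sides d v U"
    if "d \<in> D" "v \<in> {v. slides (int d * k) X v Y}" for d v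
    using code_exists[OF D] that by simp
  fix d v d' v' U
  assume "d \<in> D" "d' \<in> D"
  then have d: "d \<ge> 2" "d' \<ge> 2" using D by auto
  assume "code_one_side d v U \<or> code_two_sides d v U" "code_one_side d' v' U \<or> code_two_sides d' v' U"
  then show "d = d' \<and> v = v'"
    using code_one_side_unique[OF d, of v U v'] code_two_sides_unique[of d v U d' v']
      code_one_two_disjoint[OF d(1), of v U d' v'] code_one_two_disjoint[OF d(2), of v' U d v]
    by argo
qed

end

section \<open>The inequality\<close>

text \<open>
  If the words have different last letters, they are read backwards.
\<close>

theorem sum_card_slides_le:
  assumes k: "k > 0" and fin: "finite {w. slides k X w Y}" and D: "\<And>d. d \<in> D \<Longrightarrow> d \<ge> 2"
    and two: "card {w. slides k X w Y} \<ge> 2"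
  shows "(\<Sum>d\<in>D. card {v. slides (int d * k) X v Y}) \<le> card {w. slides k X w Y}"
proof -
  have "\<exists>w w'. slides k X w Y \<and> slides k X w' Y \<and> w \<noteq> w'"
  proof (rule ccontr)
    assume "\<not> ?thesis"
    then have "card {w. slides k X w Y} \<le> card {SOME w. slides k X w Y}"
      by (intro card_mono) (auto intro: someI2)
    then show False using two by simp
  qed
  then obtain w1 w2 where w: "slides k X w1 Y" "slides k X w2 Y" "w1 \<noteq> w2" by blast
  have ms: "mset w = mset w1" if "slides k X w Y" for w using slides_mset[OF k that w(1)] .
  have ne1: "w1 \<noteq> []" using w ms[OF w(2)] by auto
  have ne: "w \<noteq> []" if "slides k X w Y" for w using ms[OF that] ne1 by auto
  have card_rev: "card {w. slides j (- Y) w (- X)} = card {w. slides j X w Y}" if "j > 0" for j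
  proof -
    have "{w. slides j (- Y) w (- X)} = rev ` {w. slides j X w Y}"
      using slides_rev[OF that, of X _ Y] by (force simp: image_iff intro: exI[of _ "rev _"])
    then show ?thesis by (simp add: card_image inj_on_def)
  qed
  have initial: "initial_letter k A B (hd w)" if "slides k A w B" "w \<noteq> []" for A B w
    using that by (cases w) (auto simp: initial_letter_def)
  show ?thesis
  proof (cases "\<exists>w. slides k X w Y \<and> hd w \<noteq> hd w1")
    case True
    then show ?thesis
      using sum_le_two_initial_letters[OF k fin D] initial w(1) ne by metis
  next
    case same_hd: False
    show ?thesis
    proof (cases "\<exists>w. slides k X w Y \<and> last w \<noteq> last w1")
      case True
      then obtain w where w': "slides k X w Y" "last w \<noteq> last w1" by blast
      have r: "slides k (- Y) (rev w) (- X)" "slides k (- Y) (rev w1) (- X)"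
        using w' w(1) slides_rev[OF k] by blast+
      have fin': "finite {w. slides k (- Y) w (- X)}"
        using card_rev[OF k] two by (metis card.infinite not_numeral_le_zero)
      have "(\<Sum>d\<in>D. card {v. slides (int d * k) (- Y) v (- X)}) \<le> card {w. slides k (- Y) w (- X)}"
      proof (rule sum_le_two_initial_letters[OF k fin' D])
        show "initial_letter k (- Y) (- X) (last w)" "initial_letter k (- Y) (- X) (last w1)"
          using initial[OF r(1)] initial[OF r(2)] ne[OF w'(1)] ne1 by (simp_all add: hd_rev)
        show "last w \<noteq> last w1" by fact
      qed
      moreover have "(\<Sum>d\<in>D. card {v. slides (int d * k) (- Y) v (- X)}) = (\<Sum>d\<in>D. card {v. slides (int d * k) X v Y})"
      proof (intro sum.cong refl card_rev)
        show "int d * k > 0" if "d \<in> D" for d using D[OF that] k by simp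
      qed
      ultimately show ?thesis using card_rev[OF k] by simp
    next
      case False
      interpret fixed_ends k X Y "hd w1" "last w1"
        using k ne same_hd False w by unfold_locales blast+
      show ?thesis using sum_le_fixed_ends[OF fin D] .
    qed
  qed
qed

lemma BST_whole_diagram:
  assumes "card (skew_diagram lam mu) = n" "n > 0"
  shows "BST lam mu n \<subseteq> {[skew_diagram lam mu]}"
proof
  let ?D = "skew_diagram lam mu"
  fix Bs assume Bs: "Bs \<in> BST lam mu n"
  then have un: "\<Union> (set Bs) = ?D" and dist: "distinct Bs" and card: "\<And>B. B \<in> set Bs \<Longrightarrow> card B = n"
    by (auto simp: BST_def partition_on_def)
  have "finite ?D" by (simp add: skew_diagram_def finite_young_diagram)
  then have "B = ?D" if "B \<in> set Bs" for B
    using card_subset_eq[of ?D B] un card[OF that] that assms(1) by auto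
  then have "set Bs \<subseteq> {?D}" by blast
  moreover have "set Bs \<noteq> {}" using un assms by auto
  ultimately have "set Bs = {?D}" by (simp add: subset_singleton_iff)
  moreover from this have "length Bs = 1" using distinct_card[OF dist] by simp
  ultimately show "Bs \<in> {[?D]}" by (auto simp: length_Suc_conv)
qed

theorem theorem28:
  fixes lam mu :: "nat list" and n k :: nat
  assumes "skew_shape lam mu"
    and "card (skew_diagram lam mu) = n"
    and "k > 0"
    and "k dvd n"
  shows "(card (BST lam mu k) \<ge> 2 \<longrightarrow>
            card (BST lam mu k) \<ge> (\<Sum>d\<in>{d. d dvd n div k \<and> d > 1}. card (BST lam mu (d * k)))) \<and>
         (prime (n div k) \<longrightarrow>
            card (BST lam mu k) \<ge> (\<Sum>d\<in>{d. d dvd n div k \<and> d > 1}. card (BST lam mu (d * k))))"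
proof -
  let ?X = "beads (young_diagram mu)" and ?Y = "beads (young_diagram lam)"
  let ?D = "{d. d dvd n div k \<and> d > 1}"
  have k: "int k > 0" using assms(3) by simp
  have W: "card (BST lam mu k) = card {w. slides (int k) ?X w ?Y}" "finite {w. slides (int k) ?X w ?Y}"
    using card_BST finite_slides_beads assms(1,3) by blast+
  have V: "card (BST lam mu (d * k)) = card {v. slides (int d * int k) ?X v ?Y}" if "d > 0" for d
    using card_BST[OF assms(1), of "d * k"] that assms(3) by simp
  have two: "(\<Sum>d\<in>?D. card (BST lam mu (d * k))) \<le> card (BST lam mu k)" if "card (BST lam mu k) \<ge> 2"
  proof -
    have "(\<Sum>d\<in>?D. card (BST lam mu (d * k))) = (\<Sum>d\<in>?D. card {v. slides (int d * int k) ?X v ?Y})"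
      by (intro sum.cong refl V) simp
    also have "\<dots> \<le> card {w. slides (int k) ?X w ?Y}"
      using sum_card_slides_le[OF k W(2), of ?D] that W(1) by simp
    finally show ?thesis using W(1) by simp
  qed
  have "(\<Sum>d\<in>?D. card (BST lam mu (d * k))) \<le> card (BST lam mu k)" if p: "prime (n div k)"
  proof (cases "card (BST lam mu k) \<ge> 2")
    case False
    define m where "m = n div k"
    have m: "prime m" "m > 0" "m * k = n" using p assms(4) prime_gt_0_nat by (auto simp: m_def)
    have "?D = {m}" using m(1) prime_gt_1_nat by (auto simp: m_def[symmetric] prime_nat_iff)
    then have sum: "(\<Sum>d\<in>?D. card (BST lam mu (d * k))) = card (BST lam mu n)" using m(3) by simp
    show ?thesis
    proof (cases "BST lam mu n = {}")
      case True
      then show ?thesis unfolding sum by simp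
    next
      case nonempty: False
      have "n > 0" using m assms(3) by auto
      then have "card (BST lam mu n) \<le> 1"
        using card_mono[OF _ BST_whole_diagram[OF assms(2)]] by simp
      moreover have "card (BST lam mu k) \<ge> 1"
      proof -
        have "card (BST lam mu n) > 0" using nonempty finite_BST by (simp add: card_gt_0_iff)
        then have "card {v. slides (int m * int k) ?X v ?Y} \<noteq> 0" using V[OF m(2)] m(3) by simp
        then obtain v where "slides (int m * int k) ?X v ?Y" by fastforce
        then have "{w. slides (int k) ?X w ?Y} \<noteq> {}" using slides_refine[OF k m(2)] by blast
        then show ?thesis using W by (simp add: Suc_le_eq card_gt_0_iff)
      qed
      ultimately show ?thesis unfolding sum by simp
    qed
  qed (rule two)
  then show ?thesis using two by blast
qed

end
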